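(* The minimum spectral gap of connected cubic bipartite graphs on $2n$ vertices is $(1+o(1))\frac{\pi^{2}}{n^{2}}$ as $n\to\infty$. That is, if $s(n)$ denotes the minimum spectral gap over all connected cubic bipartite graphs on $2n$ vertices, then $\lim_{n\to\infty}\frac{n^{2}}{\pi^{2}}\,s(n)=1$.
   Context: All graphs are finite, simple and undirected. A graph is cubic if every vertex has degree $3$. The spectral gap of a graph $G$ is the difference between the two largest eigenvalues (counted with multiplicity) of its adjacency matrix. *)

theory Defs
  imports
    Complex_Main
    "Graph_Theory.Graph_Theory"
    "Jordan_Normal_Form.Char_Poly"
begin

text \<open>
  A finite simple undirected graph is a \<^locale>\<open>pair_graph\<close>: a finite, loop-free,
  symmetric set of arcs, so that an edge is a pair of opposite arcs and the
  degree of a vertex is its out-degree.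
\<close>

definition cubic :: "'a pair_pre_digraph \<Rightarrow> bool" where
  "cubic G \<longleftrightarrow> (\<forall>v \<in> pverts G. out_degree (with_proj G) v = 3)"

definition bipartite :: "'a pair_pre_digraph \<Rightarrow> bool" where
  "bipartite G \<longleftrightarrow> (\<exists>A B. A \<union> B = pverts G \<and> A \<inter> B = {} \<and>
     (\<forall>(u, v) \<in> parcs G. (u \<in> A \<and> v \<in> B) \<or> (u \<in> B \<and> v \<in> A)))"

text \<open>
  The following is the adjacency matrix only for graphs with vertex set
  \<open>{0..<N}\<close>; other vertex sets are not used.
\<close>

definition adjacency_matrix :: "nat pair_pre_digraph \<Rightarrow> real mat" where
  "adjacency_matrix G =
     mat (card (pverts G)) (card (pverts G)) (\<lambda>(i, j). if (i, j) \<in> parcs G then 1 else 0)"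

text \<open>
  The real roots of the characteristic polynomial with multiplicity, in
  decreasing order. For a real symmetric matrix these are all of its
  eigenvalues, so the list has full length.
\<close>

definition eigenvalues_desc :: "real mat \<Rightarrow> real list" where
  "eigenvalues_desc A = rev (sorted_list_of_multiset (proots (char_poly A)))"

definition spectral_gap :: "nat pair_pre_digraph \<Rightarrow> real" where
  "spectral_gap G =
     eigenvalues_desc (adjacency_matrix G) ! 0 - eigenvalues_desc (adjacency_matrix G) ! 1"

text \<open>
  Every graph on \<open>2 * n\<close> vertices is isomorphic to one with vertex set
  \<open>{0..<2 * n}\<close>.
\<close>

definition connected_cubic_bipartite_graphs :: "nat \<Rightarrow> nat pair_pre_digraph set" where
  "connected_cubic_bipartite_graphs n =
     {G. pair_graph G \<and> pverts G = {0..<2 * n} \<and>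
         Digraph_Component.connected (with_proj G) \<and> cubic G \<and> bipartite G}"

lemma finite_connected_cubic_bipartite_graphs: "finite (connected_cubic_bipartite_graphs n)"
proof (rule finite_subset)
  let ?V = "{0..<2 * n}"
  show "connected_cubic_bipartite_graphs n \<subseteq>
      (\<lambda>E. \<lparr>pverts = ?V, parcs = E\<rparr>) ` Pow (?V \<times> ?V)"
  proof
    fix G assume "G \<in> connected_cubic_bipartite_graphs n"
    then have G: "pair_graph G" and V: "pverts G = ?V"
      by (auto simp: connected_cubic_bipartite_graphs_def)
    interpret pair_graph G by (fact G)
    have "parcs G \<subseteq> ?V \<times> ?V"
      using in_arcsD1 in_arcsD2 V by auto
    moreover have "G = \<lparr>pverts = ?V, parcs = parcs G\<rparr>"
      using V by (cases G) simp
    ultimately show "G \<in> (\<lambda>E. \<lparr>pverts = ?V, parcs = E\<rparr>) ` Pow (?V \<times> ?V)"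
      by blast
  qed
qed auto

text \<open>
  By the previous lemma this is the minimum of a finite set. The set is empty,
  and the value unspecified, exactly for \<open>n < 3\<close>.
\<close>

definition min_spectral_gap :: "nat \<Rightarrow> real" where
  "min_spectral_gap n = Min (spectral_gap ` connected_cubic_bipartite_graphs n)"

end

theory Submission
  imports Defs "HOL-Real_Asymp.Real_Asymp"
begin

text \<open>
  The proof sandwiches the minimum \<open>s(n)\<close> between two explicit numbers: for \<open>n \<ge> 8\<close>,
  \<open>2 - 2 cos (\<pi> / n) \<le> s(n) \<le> 2 - 2 cos (\<pi> / (n - 6))\<close>.
  Both bounds are \<open>(1 + o(1)) \<pi>\<^sup>2 / n\<^sup>2\<close>.

  For a connected \<open>d\<close>-regular graph the largest eigenvalue is \<open>d\<close>, its eigenvectors are the constant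
  functions, and \<open>d |x|\<^sup>2 - x\<^sup>T A x\<close> is the Dirichlet energy, the sum of \<open>(x\<^sub>u - x\<^sub>v)\<^sup>2\<close> over
  the edges. So by the spectral theorem the gap is the minimum of the energy of \<open>x\<close> over \<open>|x|\<^sup>2\<close>, for
  \<open>x\<close> with sum 0 (\<open>adjacency_spectral_gap\<close>). The number \<open>2 - 2 cos (\<pi> / n)\<close> is the same minimum
  for the path on \<open>n\<close> vertices (\<open>path_poincare\<close>, \<open>path_cosine_energy\<close>), and both bounds compare
  a cubic graph on \<open>2n\<close> vertices with a path of pairs of vertices.

  Lower bound (\<open>energy_ge\<close>). Sort the vertices so that \<open>y\<^sub>0 \<ge> y\<^sub>1 \<ge> \<dots>\<close>, and put
  \<open>d\<^sub>i = y\<^sub>i - y\<^bsub>i+1\<^esub> \<ge> 0\<close>. Let \<open>c\<^sub>i\<close> be the number of edges between the first \<open>i + 1\<close> vertices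
  and the others, and \<open>p\<^sub>i\<close> the number of edges that pass over vertex \<open>i + 1\<close>, that is, are counted in
  both \<open>c\<^sub>i\<close> and \<open>c\<^bsub>i+1\<^esub>\<close>. An edge from \<open>u\<close> to \<open>v > u\<close> has energy \<open>(d\<^sub>u + \<dots> + d\<^bsub>v-1\<^esub>)\<^sup>2\<close>;
  keeping only the squares and the products of neighbouring differences, the energy is at least
  \<open>\<Sum> c\<^sub>i d\<^sub>i\<^sup>2 + 2 \<Sum> p\<^sub>i d\<^sub>i d\<^bsub>i+1\<^esub>\<close> (\<open>energy_ge_cut_sums\<close>). Counting edges by colour shows that a cut of
  a cubic bipartite graph never consists of one edge, and has as many edges as its side has vertices
  modulo 2 (\<open>card_cut_ge\<close>). So \<open>c\<^sub>i \<ge> 3\<close> for even \<open>i\<close> and \<open>c\<^sub>i \<ge> 2\<close> for odd \<open>i\<close>, and since the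
  degree is 3, \<open>p\<^sub>i = (c\<^sub>i + c\<^bsub>i+1\<^esub> - 3) / 2 \<ge> 1\<close> (\<open>card_consecutive_cuts\<close>). These coefficients are just
  large enough to bound the energy below by twice the path energy of the means
  \<open>h\<^sub>k = (y\<^bsub>2k\<^esub> + y\<^bsub>2k+1\<^esub>) / 2\<close> plus \<open>\<Sum> (y\<^bsub>2k\<^esub> - y\<^bsub>2k+1\<^esub>)\<^sup>2\<close>, and the path inequality for \<open>h\<close> finishes the
  argument (\<open>energy_ge_sorted\<close>).

  Upper bound (\<open>spectral_gap_ladder_le\<close>). In the ladder, both sides of this estimate agree to leading
  order. Turn each end of the ladder with \<open>n\<close> rungs into a copy of \<open>K\<^bsub>3,3\<^esub>\<close> minus an edge on the last three
  rungs, to make the graph cubic. The first nonconstant eigenvector of the path on the \<open>n - 6\<close> middle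
  rungs, continued by constants on the two end blocks, is a test function with the required quotient.
\<close>

section \<open>The spectral theorem for real symmetric matrices\<close>

text \<open>
  The reflection in the hyperplane orthogonal to \<open>u\<close>. For \<open>u = 0\<close> the quotient is \<open>2 / 0 = 0\<close> and the
  matrix is the identity.
\<close>

definition householder :: "real vec \<Rightarrow> real mat" where
  "householder u = mat (dim_vec u) (dim_vec u)
     (\<lambda>(i, j). (if i = j then 1 else 0) - 2 / (u \<bullet> u) * (u $ i * u $ j))"

lemma householder_carrier [simp]: "u \<in> carrier_vec n \<Longrightarrow> householder u \<in> carrier_mat n n"
  by (simp add: householder_def)

lemma transpose_householder [simp]: "transpose_mat (householder u) = householder u"
  by (rule eq_matI) (auto simp: householder_def mult.commute)

lemma householder_involution:
  assumes u: "u \<in> carrier_vec n"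
  shows "householder u * householder u = 1\<^sub>m n"
proof (rule eq_matI)
  fix i j assume "i < dim_row (1\<^sub>m n :: real mat)" "j < dim_col (1\<^sub>m n :: real mat)"
  then have i: "i < n" and j: "j < n" by auto
  define c where "c = 2 / (u \<bullet> u)"
  have c: "c * c * (u \<bullet> u) = 2 * c" by (simp add: c_def)
  have "(householder u * householder u) $$ (i, j) =
      (\<Sum>k\<in>{0..<n}. ((if i = k then 1 else 0) - c * (u $ i * u $ k)) *
                      ((if k = j then 1 else 0) - c * (u $ k * u $ j)))"
    using u i j by (simp add: householder_def scalar_prod_def c_def)
  also have "\<dots> = (\<Sum>k\<in>{0..<n}. (if i = k then (if k = j then 1 else 0) else 0)
      - (if i = k then c * u $ k * u $ j else 0) - (if k = j then c * u $ i * u $ k else 0)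
      + c * c * u $ i * u $ j * (u $ k * u $ k))"
    by (rule sum.cong) (auto simp: algebra_simps)
  also have "\<dots> = (if i = j then 1 else 0) - c * u $ i * u $ j - c * u $ i * u $ j
      + c * c * u $ i * u $ j * (\<Sum>k\<in>{0..<n}. u $ k * u $ k)"
    using i j by (simp add: sum.distrib sum_subtractf sum_distrib_left)
  also have "(\<Sum>k\<in>{0..<n}. u $ k * u $ k) = u \<bullet> u"
    using u by (simp add: scalar_prod_def)
  also have "(if i = j then 1 else 0) - c * u $ i * u $ j - c * u $ i * u $ j
      + c * c * u $ i * u $ j * (u \<bullet> u) = (if i = j then 1 else 0)
      + (c * c * (u \<bullet> u) - 2 * c) * (u $ i * u $ j)"
    by (simp add: algebra_simps)
  finally show "(householder u * householder u) $$ (i, j) = 1\<^sub>m n $$ (i, j)"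
    using i j by (simp add: c)
qed (use u in \<open>auto simp: householder_def\<close>)

text \<open>
  Reflecting in the bisector of two unit vectors swaps them, here \<open>v\<close> and the first basis vector. So
  every unit vector is the first column of an explicit symmetric orthogonal matrix, which serves as a
  change of basis without any orthogonalisation procedure.
\<close>

lemma householder_col_0:
  assumes v: "v \<in> carrier_vec n" "v \<bullet> v = 1" and n: "0 < n"
  shows "col (householder (v - unit_vec n 0)) 0 = v"
proof (rule eq_vecI)
  define u where "u = v - unit_vec n 0"
  have u: "u \<in> carrier_vec n" using v by (simp add: u_def)
  have uu: "u \<bullet> u = - 2 * u $ 0"
  proof -
    have "u \<bullet> u = (\<Sum>k\<in>{0..<n}. v $ k * v $ k - (if k = 0 then 2 * v $ 0 - 1 else 0))"
      using v by (auto simp: u_def scalar_prod_def algebra_simps intro!: sum.cong)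
    also have "\<dots> = v \<bullet> v - (2 * v $ 0 - 1)"
      using v n by (simp add: scalar_prod_def sum_subtractf)
    finally show ?thesis using v n by (simp add: u_def)
  qed
  fix i assume "i < dim_vec v"
  then have i: "i < n" using v by simp
  have "col (householder u) 0 $ i = (if i = 0 then 1 else 0) - 2 / (u \<bullet> u) * (u $ i * u $ 0)"
    using u i n by (simp add: householder_def)
  also have "\<dots> = (if i = 0 then 1 else 0) + u $ i"
  proof (cases "u $ 0 = 0")
    case True
    with uu have "u \<bullet> u = 0" by simp
    then have "(\<Sum>k\<in>{0..<n}. u $ k * u $ k) = 0" using u by (simp add: scalar_prod_def)
    then have "\<forall>k\<in>{0..<n}. u $ k * u $ k = 0" by (subst (asm) sum_nonneg_eq_0_iff) auto
    then show ?thesis using i True by simp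
  qed (simp add: uu)
  also have "\<dots> = v $ i" using v i n by (auto simp: u_def)
  finally show "col (householder (v - unit_vec n 0)) 0 $ i = v $ i" by (simp add: u_def)
qed (use v in \<open>auto simp: householder_def\<close>)

text \<open>
  The characteristic polynomial has a complex root \<open>a\<close>. With an eigenvector \<open>z\<close>, the number
  \<open>z\<^sup>* A z = a |z|\<^sup>2\<close> equals its own conjugate because \<open>A\<close> is real and symmetric, so \<open>a\<close> is real, and
  a real eigenvalue of a real matrix has a real eigenvector.
\<close>

lemma symmetric_real_mat_eigenvector:
  fixes A :: "real mat"
  assumes A: "A \<in> carrier_mat n n" and sym: "transpose_mat A = A" and n: "0 < n"
  obtains v e where "v \<in> carrier_vec n" "v \<bullet> v = 1" "A *\<^sub>v v = e \<cdot>\<^sub>v v"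
proof -
  let ?C = "map_mat complex_of_real A"
  have C: "?C \<in> carrier_mat n n" using A by simp
  have "degree (char_poly ?C) = n" using degree_monic_char_poly[OF C] by simp
  then have "\<not> constant (poly (char_poly ?C))" using n by (simp add: constant_degree)
  then obtain a where a: "poly (char_poly ?C) a = 0"
    using fundamental_theorem_of_algebra by blast
  then obtain z where z: "eigenvector ?C z a"
    using eigenvalue_root_char_poly[OF C] by (auto simp: eigenvalue_def)
  then have zc: "z \<in> carrier_vec n" and z0: "z \<noteq> 0\<^sub>v n" and za: "?C *\<^sub>v z = a \<cdot>\<^sub>v z"
    using A by (auto simp: eigenvector_def)
  have zi: "(\<Sum>j\<in>{0..<n}. of_real (A $$ (i, j)) * z $ j) = a * z $ i" if "i < n" for i
    using arg_cong[OF za, of "\<lambda>w. w $ i"] that A zc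
    by (simp add: scalar_prod_def)
  have symA: "A $$ (i, j) = A $$ (j, i)" if "i < n" "j < n" for i j
    using arg_cong[OF sym, of "\<lambda>M. M $$ (i, j)"] that A by simp
  define s where "s = (\<Sum>i\<in>{0..<n}. (cmod (z $ i))\<^sup>2)"
  define q where "q = (\<Sum>i\<in>{0..<n}. \<Sum>j\<in>{0..<n}. cnj (z $ i) * (of_real (A $$ (i, j)) * z $ j))"
  have q: "q = a * of_real s"
  proof -
    have "q = (\<Sum>i\<in>{0..<n}. cnj (z $ i) * (a * z $ i))"
      unfolding q_def by (intro sum.cong refl) (simp add: zi flip: sum_distrib_left)
    also have "\<dots> = (\<Sum>i\<in>{0..<n}. a * of_real ((cmod (z $ i))\<^sup>2))"
      by (intro sum.cong refl) (simp add: complex_norm_square mult_ac del: of_real_power)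
    finally show ?thesis by (simp add: s_def sum_distrib_left)
  qed
  have "cnj q = (\<Sum>i\<in>{0..<n}. \<Sum>j\<in>{0..<n}. cnj (z $ j) * (of_real (A $$ (j, i)) * z $ i))"
    unfolding q_def by (simp add: mult_ac symA)
  also have "\<dots> = q" unfolding q_def by (rule sum.swap)
  finally have "cnj q = q" .
  have "0 < s"
  proof (rule ccontr)
    assume "\<not> 0 < s"
    moreover have "0 \<le> s" by (simp add: s_def sum_nonneg)
    ultimately have "s = 0" by simp
    then have "\<forall>i\<in>{0..<n}. (cmod (z $ i))\<^sup>2 = 0"
      unfolding s_def by (subst (asm) sum_nonneg_eq_0_iff) auto
    with z0 zc show False by (auto intro: eq_vecI)
  qed
  from \<open>cnj q = q\<close> q \<open>0 < s\<close> have "cnj a = a" by simp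
  then obtain e where e: "a = of_real e" by (metis Reals_cases Reals_cnj_iff)
  have "eigenvalue A e"
    using a unfolding e eigenvalue_root_char_poly[OF A] of_real_hom.char_poly_hom[OF A]
    by simp
  then obtain w where w: "w \<in> carrier_vec n" "w \<noteq> 0\<^sub>v n" "A *\<^sub>v w = e \<cdot>\<^sub>v w"
    using A by (auto simp: eigenvalue_def eigenvector_def)
  have ww: "0 < w \<bullet> w"
  proof (rule ccontr)
    assume "\<not> 0 < w \<bullet> w"
    then have "(\<Sum>i\<in>{0..<n}. w $ i * w $ i) = 0"
      using w by (simp add: scalar_prod_def antisym sum_nonneg)
    then have "\<forall>i\<in>{0..<n}. w $ i * w $ i = 0"
      by (subst (asm) sum_nonneg_eq_0_iff) auto
    with w show False by (auto intro: eq_vecI)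
  qed
  show thesis
  proof
    show "(1 / sqrt (w \<bullet> w)) \<cdot>\<^sub>v w \<in> carrier_vec n" using w by simp
    show "((1 / sqrt (w \<bullet> w)) \<cdot>\<^sub>v w) \<bullet> ((1 / sqrt (w \<bullet> w)) \<cdot>\<^sub>v w) = 1"
      using w ww by simp
    show "A *\<^sub>v ((1 / sqrt (w \<bullet> w)) \<cdot>\<^sub>v w) = e \<cdot>\<^sub>v ((1 / sqrt (w \<bullet> w)) \<cdot>\<^sub>v w)"
      using w A by (simp add: mult_mat_vec smult_smult_assoc mult.commute)
  qed
qed

text \<open>
  Induction on the size: in a basis that starts with a unit eigenvector the first column of the matrix
  is a multiple of the first basis vector, by symmetry so is the first row, and the induction hypothesis
  applies to the remaining block.
\<close>

theorem symmetric_real_mat_diagonalization: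
  fixes A :: "real mat"
  assumes "A \<in> carrier_mat n n" "transpose_mat A = A"
  obtains U D where "U \<in> carrier_mat n n" "D \<in> carrier_mat n n"
    "transpose_mat U * U = 1\<^sub>m n" "transpose_mat U * A * U = D" "diagonal_mat D"
  using assms
proof (induction n arbitrary: A thesis)
  case 0
  show ?case
    by (rule "0.prems"(1)[of "1\<^sub>m 0" A]) (use "0.prems"(2) in \<open>auto simp: diagonal_mat_def\<close>)
next
  case (Suc m)
  let ?n = "Suc m"
  from Suc.prems have A: "A \<in> carrier_mat ?n ?n" and sym: "transpose_mat A = A" by auto
  obtain v e where v: "v \<in> carrier_vec ?n" "v \<bullet> v = 1" and ev: "A *\<^sub>v v = e \<cdot>\<^sub>v v"
    using symmetric_real_mat_eigenvector[OF A sym] by blast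
  define W where "W = householder (v - unit_vec ?n 0)"
  have W: "W \<in> carrier_mat ?n ?n" using v by (simp add: W_def)
  have W0: "col W 0 = v" using householder_col_0[OF v] by (simp add: W_def)
  have WW: "W * W = 1\<^sub>m ?n" unfolding W_def by (rule householder_involution) (use v in auto)
  have WT: "transpose_mat W = W" by (simp add: W_def)
  define B where "B = W * A * W"
  have B: "B \<in> carrier_mat ?n ?n" using W A by (simp add: B_def)
  have BT: "transpose_mat B = B"
    unfolding B_def using W A
    by (simp add: transpose_mult[of _ ?n ?n _ ?n] WT sym assoc_mult_mat[of _ ?n ?n _ ?n _ ?n])
  have colB: "col B 0 = e \<cdot>\<^sub>v unit_vec ?n 0"
  proof -
    have "col B 0 = (W * A) *\<^sub>v col W 0"
      unfolding B_def by (rule col_mult2[of _ ?n ?n _ ?n]) (use W A in auto)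
    also have "\<dots> = W *\<^sub>v (A *\<^sub>v v)"
      unfolding W0 by (rule assoc_mult_mat_vec) (use W A v in auto)
    also have "\<dots> = e \<cdot>\<^sub>v (W *\<^sub>v col W 0)"
      unfolding ev W0 by (rule mult_mat_vec) (use W v in auto)
    also have "W *\<^sub>v col W 0 = col (W * W) 0"
      by (rule col_mult2[symmetric, of _ ?n ?n _ ?n]) (use W in auto)
    finally show ?thesis by (simp add: WW)
  qed
  have B0: "B $$ (i, 0) = (if i = 0 then e else 0)" if "i < ?n" for i
    using arg_cong[OF colB, of "\<lambda>w. w $ i"] that B by auto
  have B0': "B $$ (0, i) = (if i = 0 then e else 0)" if "i < ?n" for i
    using B0[OF that] arg_cong[OF BT, of "\<lambda>M. M $$ (i, 0)"] that B by simp
  define E where "E = mat 1 1 (\<lambda>_. e)"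
  define C where "C = mat m m (\<lambda>(i, j). B $$ (Suc i, Suc j))"
  have E: "E \<in> carrier_mat 1 1" and C: "C \<in> carrier_mat m m" by (auto simp: E_def C_def)
  have block: "B = four_block_mat E (0\<^sub>m 1 m) (0\<^sub>m m 1) C"
    by (rule eq_matI) (use B in \<open>auto simp: E_def C_def B0 B0'\<close>)
  have "transpose_mat C = C"
  proof (rule eq_matI)
    fix i j assume "i < dim_row C" "j < dim_col C"
    then show "transpose_mat C $$ (i, j) = C $$ (i, j)"
      using arg_cong[OF BT, of "\<lambda>M. M $$ (Suc i, Suc j)"] B C by (simp add: C_def)
  qed (use C in auto)
  from Suc.IH[OF _ C this] obtain V D where V: "V \<in> carrier_mat m m" and D: "D \<in> carrier_mat m m"
    and VV: "transpose_mat V * V = 1\<^sub>m m" and VCV: "transpose_mat V * C * V = D"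
    and diag: "diagonal_mat D" by blast
  define F where "F = four_block_mat (1\<^sub>m 1) (0\<^sub>m 1 m) (0\<^sub>m m 1) V"
  have F: "F \<in> carrier_mat ?n ?n" using V by (auto simp: F_def)
  have FT: "transpose_mat F = four_block_mat (1\<^sub>m 1) (0\<^sub>m 1 m) (0\<^sub>m m 1) (transpose_mat V)"
    unfolding F_def by (subst transpose_four_block_mat[of _ 1 1 _ m _ m]) (use V in auto)
  have FF: "transpose_mat F * F = 1\<^sub>m ?n"
    unfolding FT unfolding F_def
    by (subst mult_four_block_mat[of _ 1 1 _ m _ m _ _ 1 _ m])
       (use V VV in \<open>auto intro!: eq_matI\<close>)
  have FB: "transpose_mat F * B = four_block_mat E (0\<^sub>m 1 m) (0\<^sub>m m 1) (transpose_mat V * C)"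
    unfolding FT block
    by (subst mult_four_block_mat[of _ 1 1 _ m _ m _ _ 1 _ m]) (use V C E in auto)
  have FBF: "transpose_mat F * B * F = four_block_mat E (0\<^sub>m 1 m) (0\<^sub>m m 1) D"
    unfolding FB unfolding F_def
    by (subst mult_four_block_mat[of _ 1 1 _ m _ m _ _ 1 _ m]) (use V C E VCV in auto)
  have UT: "transpose_mat (W * F) = transpose_mat F * W"
    using W F by (simp add: transpose_mult[of _ ?n ?n _ ?n] WT)
  show ?case
  proof (rule Suc.prems(1))
    show "W * F \<in> carrier_mat ?n ?n" using W F by simp
    show "four_block_mat E (0\<^sub>m 1 m) (0\<^sub>m m 1) D \<in> carrier_mat ?n ?n" using E D by auto
    have "transpose_mat (W * F) * (W * F) = transpose_mat F * (W * W) * F"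
      unfolding UT using W F by (simp add: assoc_mult_mat[of _ ?n ?n _ ?n _ ?n])
    then show "transpose_mat (W * F) * (W * F) = 1\<^sub>m ?n" using F by (simp add: WW FF)
    have "transpose_mat (W * F) * A * (W * F) = transpose_mat F * B * F"
      unfolding UT B_def using W F A by (simp add: assoc_mult_mat[of _ ?n ?n _ ?n _ ?n])
    then show "transpose_mat (W * F) * A * (W * F) = four_block_mat E (0\<^sub>m 1 m) (0\<^sub>m m 1) D"
      by (simp add: FBF)
    show "diagonal_mat (four_block_mat E (0\<^sub>m 1 m) (0\<^sub>m m 1) D)"
      using diag E D by (auto simp: diagonal_mat_def)
  qed
qed

text \<open>
  The form in which the spectral theorem is used: \<open>v i\<close> is the unit eigenvector for the \<open>i\<close>-th largest
  eigenvalue, and the norm and the quadratic form of \<open>x\<close> are expressed by its coordinates in that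
  basis. Eigenvalues and eigenvectors of the diagonalization only need to be permuted, because the
  characteristic polynomial of a diagonal matrix has its diagonal as multiset of roots.
\<close>

theorem symmetric_real_mat_eigenvalues_desc:
  fixes A :: "real mat"
  assumes A: "A \<in> carrier_mat n n" and sym: "transpose_mat A = A"
  obtains v :: "nat \<Rightarrow> nat \<Rightarrow> real" where
    "length (eigenvalues_desc A) = n"
    "\<And>i j. i \<le> j \<Longrightarrow> j < n \<Longrightarrow> eigenvalues_desc A ! j \<le> eigenvalues_desc A ! i"
    "\<And>i j. i < n \<Longrightarrow> j < n \<Longrightarrow> (\<Sum>a<n. v i a * v j a) = (if i = j then 1 else 0)"
    "\<And>x. (\<Sum>a<n. (x a)\<^sup>2) = (\<Sum>i<n. (\<Sum>a<n. v i a * x a)\<^sup>2)"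
    "\<And>x. (\<Sum>a<n. \<Sum>b<n. A $$ (a, b) * x a * x b) =
      (\<Sum>i<n. eigenvalues_desc A ! i * (\<Sum>a<n. v i a * x a)\<^sup>2)"
proof -
  obtain U D where U: "U \<in> carrier_mat n n" and D: "D \<in> carrier_mat n n"
    and UU: "transpose_mat U * U = 1\<^sub>m n" and UAU: "transpose_mat U * A * U = D"
    and diag: "diagonal_mat D"
    using symmetric_real_mat_diagonalization[OF A sym] by blast
  have UT: "transpose_mat U \<in> carrier_mat n n" using U by simp
  have UU': "U * transpose_mat U = 1\<^sub>m n"
    by (rule mat_mult_left_right_inverse[OF UT U UU])
  have A_eq: "A = U * D * transpose_mat U"
  proof -
    have "U * D * transpose_mat U = (U * transpose_mat U) * A * (U * transpose_mat U)"
      unfolding UAU[symmetric] using U UT A by (simp add: assoc_mult_mat[of _ n n _ n _ n])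
    then show ?thesis using A by (simp add: UU')
  qed
  define ds where "ds = diag_mat D"
  have len: "length ds = n" using D by (simp add: ds_def diag_mat_def)
  have ds: "D $$ (i, i) = ds ! i" if "i < n" for i
    using D that by (simp add: ds_def diag_mat_def)
  have D_eq: "D $$ (i, j) = (if i = j then ds ! i else 0)" if "i < n" "j < n" for i j
    using diag D that by (auto simp: diagonal_mat_def ds)

  have "similar_mat A D"
    by (rule similar_matI[where P = U and Q = "transpose_mat U" and n = n])
       (use A D U UU UU' A_eq in auto)
  then have "char_poly A = char_poly D" by (rule char_poly_similar)
  also have "upper_triangular D"
    using diag D by (auto simp: upper_triangular_def diagonal_mat_def)
  then have "char_poly D = (\<Prod>a\<leftarrow>ds. [:- a, 1:])"
    unfolding ds_def by (rule char_poly_upper_triangular[OF D])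
  also have "proots (\<Prod>a\<leftarrow>as. [:- a, 1:]) = mset as" for as :: "real list"
  proof (induction as)
    case (Cons a as)
    have "(\<Prod>a\<leftarrow>as. [:- a, 1:]) \<noteq> 0" for as :: "real list"
      by (induction as) (simp_all del: mult_pCons_left)
    then have "proots ([:- a, 1:] * (\<Prod>a\<leftarrow>as. [:- a, 1:])) = {#a#} + mset as"
      by (subst proots_mult) (auto simp: Cons.IH)
    then show ?case by simp
  qed simp
  note proots = this
  define es where "es = eigenvalues_desc A"
  have "mset es = mset ds"
    unfolding es_def eigenvalues_desc_def \<open>char_poly A = _\<close>
      \<open>char_poly D = _\<close> proots by simp
  then obtain p where p: "p permutes {..<length ds}" and es: "permute_list p ds = es"
    by (rule mset_eq_permutation)
  have p: "p permutes {..<n}" using p by (simp add: len)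
  have es_nth: "es ! i = ds ! p i" if "i < n" for i
    using that p len permute_list_nth[of p ds i] by (simp add: es)
  have p_lt: "p i < n" if "i < n" for i using permutes_in_image[OF p] that by auto
  have p_sum: "(\<Sum>i<n. f (p i)) = (\<Sum>i<n. f i)" for f :: "nat \<Rightarrow> real"
    using sum.permute[OF p, of f] by (simp add: o_def)
  have "length es = n" using es len by auto
  moreover have "es ! j \<le> es ! i" if "i \<le> j" "j < n" for i j
  proof -
    have "sorted (rev es)" by (simp add: es_def eigenvalues_desc_def)
    then show ?thesis using that \<open>length es = n\<close> by (simp add: sorted_rev_nth_mono)
  qed
  moreover define v where "v i a = U $$ (a, p i)" for i a
  have "(\<Sum>a<n. v i a * v j a) = (if i = j then 1 else 0)" if "i < n" "j < n" for i j
  proof -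
    have "(\<Sum>a<n. v i a * v j a) = (transpose_mat U * U) $$ (p i, p j)"
      using U p_lt that by (simp add: v_def scalar_prod_def atLeast0LessThan)
    also have "\<dots> = (if p i = p j then 1 else 0)" using p_lt that by (simp add: UU)
    finally show ?thesis using permutes_inj[OF p] by (auto simp: inj_eq)
  qed
  moreover have quad: "(\<Sum>a<n. \<Sum>b<n. (\<Sum>i<n. c i * U $$ (a, i) * U $$ (b, i)) * x a * x b) =
      (\<Sum>i<n. c i * (\<Sum>a<n. U $$ (a, i) * x a)\<^sup>2)" for c x :: "nat \<Rightarrow> real"
  proof -
    have "(\<Sum>a<n. \<Sum>b<n. (\<Sum>i<n. c i * U $$ (a, i) * U $$ (b, i)) * x a * x b) =
        (\<Sum>a<n. \<Sum>b<n. \<Sum>i<n. c i * ((U $$ (a, i) * x a) * (U $$ (b, i) * x b)))"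
      by (simp only: sum_distrib_right) (simp only: mult_ac)
    also have "\<dots> = (\<Sum>a<n. \<Sum>i<n. \<Sum>b<n. c i * ((U $$ (a, i) * x a) * (U $$ (b, i) * x b)))"
      by (intro sum.cong refl sum.swap)
    also have "\<dots> = (\<Sum>i<n. \<Sum>a<n. \<Sum>b<n. c i * ((U $$ (a, i) * x a) * (U $$ (b, i) * x b)))"
      by (rule sum.swap)
    also have "\<dots> = (\<Sum>i<n. c i * (\<Sum>a<n. U $$ (a, i) * x a)\<^sup>2)"
      by (simp only: power2_eq_square sum_product) (simp only: sum_distrib_left)
    finally show ?thesis .
  qed
  moreover have "(\<Sum>a<n. (x a)\<^sup>2) = (\<Sum>i<n. (\<Sum>a<n. v i a * x a)\<^sup>2)" for x
  proof -
    have "(\<Sum>i<n. U $$ (a, i) * U $$ (b, i)) = (if a = b then 1 else 0)" if "a < n" "b < n" for a b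
      using arg_cong[OF UU', of "\<lambda>M. M $$ (a, b)"] U that
      by (simp add: scalar_prod_def atLeast0LessThan)
    then have "(\<Sum>a<n. \<Sum>b<n. (\<Sum>i<n. 1 * U $$ (a, i) * U $$ (b, i)) * x a * x b) =
        (\<Sum>a<n. \<Sum>b<n. if a = b then x a * x a else 0)"
      by (intro sum.cong refl) auto
    also have "\<dots> = (\<Sum>a<n. (x a)\<^sup>2)"
      by (intro sum.cong refl) (simp add: power2_eq_square)
    finally show ?thesis
      using p_sum[of "\<lambda>i. (\<Sum>a<n. U $$ (a, i) * x a)\<^sup>2"] unfolding quad v_def by simp
  qed
  moreover have "(\<Sum>a<n. \<Sum>b<n. A $$ (a, b) * x a * x b) =
      (\<Sum>i<n. es ! i * (\<Sum>a<n. v i a * x a)\<^sup>2)" for x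
  proof -
    have "A $$ (a, b) = (\<Sum>i<n. ds ! i * U $$ (a, i) * U $$ (b, i))" if "a < n" "b < n" for a b
    proof -
      have UD: "(U * D) $$ (a, i) = ds ! i * U $$ (a, i)" if "i < n" for i
      proof -
        have "(U * D) $$ (a, i) = (\<Sum>j<n. U $$ (a, j) * D $$ (j, i))"
          using U D \<open>a < n\<close> that by (simp add: scalar_prod_def atLeast0LessThan)
        also have "\<dots> = (\<Sum>j<n. if j = i then ds ! i * U $$ (a, i) else 0)"
          using that by (intro sum.cong refl) (auto simp: D_eq)
        finally have "(U * D) $$ (a, i) = (\<Sum>j<n. if j = i then ds ! i * U $$ (a, i) else 0)" .
        then show ?thesis using that by simp
      qed
      have "A $$ (a, b) = (\<Sum>i<n. (U * D) $$ (a, i) * U $$ (b, i))"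
        unfolding A_eq using U D that
        by (simp add: scalar_prod_def atLeast0LessThan del: assoc_mult_mat)
      then show ?thesis by (simp add: UD)
    qed
    then have "(\<Sum>a<n. \<Sum>b<n. A $$ (a, b) * x a * x b) =
        (\<Sum>a<n. \<Sum>b<n. (\<Sum>i<n. ds ! i * U $$ (a, i) * U $$ (b, i)) * x a * x b)"
      by (intro sum.cong refl) simp
    also have "\<dots> = (\<Sum>i<n. es ! i * (\<Sum>a<n. v i a * x a)\<^sup>2)"
      using p_sum[of "\<lambda>i. ds ! i * (\<Sum>a<n. U $$ (a, i) * x a)\<^sup>2"]
      unfolding quad v_def by (simp add: es_nth)
    finally show ?thesis .
  qed
  ultimately show thesis unfolding es_def by (intro that[of v])
qed

section \<open>Discrete Poincare inequality on a path\<close>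

text \<open>
  The positive ground state \<open>s k = sin (k \<pi> / n)\<close> satisfies
  \<open>s (k + 1) + s (k - 1) = 2 cos (\<pi> / n) s k\<close>. Bounding each product \<open>2 z\<^sub>k z\<^bsub>k+1\<^esub>\<close> by
  \<open>(s\<^bsub>k+1\<^esub> / s\<^sub>k) z\<^sub>k\<^sup>2 + (s\<^sub>k / s\<^bsub>k+1\<^esub>) z\<^bsub>k+1\<^esub>\<^sup>2\<close> and collecting the coefficients of \<open>z\<^sub>k\<^sup>2\<close> turns
  this recurrence into the inequality, with the sharp constant.
\<close>

lemma path_poincare_dirichlet:
  fixes z :: "nat \<Rightarrow> real"
  assumes "z 0 = 0" "z n = 0" "2 \<le> n"
  shows "(2 - 2 * cos (pi / real n)) * (\<Sum>k<n. (z k)\<^sup>2) \<le> (\<Sum>k<n. (z (Suc k) - z k)\<^sup>2)"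
proof -
  define s where "s k = sin (real k * pi / real n)" for k
  have s_pos: "0 < s k" if "0 < k" "k < n" for k
    unfolding s_def using that by (intro sin_gt_zero) (auto simp: field_simps)
  have s_rec: "s (Suc (Suc k)) + s k = 2 * cos (pi / real n) * s (Suc k)" for k
  proof -
    define t where "t = real (Suc k) * pi / real n"
    have "s (Suc (Suc k)) = sin (t + pi / real n)" "s (Suc k) = sin t" "s k = sin (t - pi / real n)"
      using assms(3) by (simp_all add: s_def t_def add_divide_distrib algebra_simps)
    then show ?thesis by (simp add: sin_add sin_diff)
  qed
  have s_0: "s 0 = 0" "s n = 0" using assms by (auto simp: s_def)
  obtain m where n: "n = Suc (Suc m)"
    using assms(3) by (metis Suc_le_D numeral_2_eq_2 Suc_le_mono)
  have young: "2 * z (Suc k) * z (Suc (Suc k)) \<le>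
      s (Suc (Suc k)) / s (Suc k) * (z (Suc k))\<^sup>2 +
      s (Suc k) / s (Suc (Suc k)) * (z (Suc (Suc k)))\<^sup>2" if "k < m" for k
  proof -
    define a b where "a = s (Suc k)" and "b = s (Suc (Suc k))"
    have ab: "0 < a" "0 < b" using that by (auto simp: a_def b_def n intro!: s_pos)
    have "0 \<le> (b * z (Suc k) - a * z (Suc (Suc k)))\<^sup>2 / (a * b)" using ab by simp
    also have "\<dots> = b / a * (z (Suc k))\<^sup>2 + a / b * (z (Suc (Suc k)))\<^sup>2
        - 2 * z (Suc k) * z (Suc (Suc k))"
      using ab by (simp add: field_simps power2_eq_square)
    finally show ?thesis by (simp add: a_def b_def)
  qed
  have "(\<Sum>k<m. 2 * z (Suc k) * z (Suc (Suc k))) \<le>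
      (\<Sum>k<m. s (Suc (Suc k)) / s (Suc k) * (z (Suc k))\<^sup>2) +
      (\<Sum>k<m. s (Suc k) / s (Suc (Suc k)) * (z (Suc (Suc k)))\<^sup>2)"
    unfolding sum.distrib[symmetric] by (rule sum_mono) (use young in auto)
  also have "(\<Sum>k<m. s (Suc (Suc k)) / s (Suc k) * (z (Suc k))\<^sup>2) =
      (\<Sum>k<Suc m. s (Suc (Suc k)) / s (Suc k) * (z (Suc k))\<^sup>2)"
    using s_0 by (simp add: n)
  also have "(\<Sum>k<m. s (Suc k) / s (Suc (Suc k)) * (z (Suc (Suc k)))\<^sup>2) =
      (\<Sum>k<Suc m. s k / s (Suc k) * (z (Suc k))\<^sup>2)"
    by (subst sum.lessThan_Suc_shift) (simp add: s_0)
  also have "(\<Sum>k<Suc m. s (Suc (Suc k)) / s (Suc k) * (z (Suc k))\<^sup>2) +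
      (\<Sum>k<Suc m. s k / s (Suc k) * (z (Suc k))\<^sup>2) =
      (\<Sum>k<Suc m. 2 * cos (pi / real n) * (z (Suc k))\<^sup>2)"
    unfolding sum.distrib[symmetric]
  proof (rule sum.cong)
    fix k assume "k \<in> {..<Suc m}"
    then have "0 < s (Suc k)" by (intro s_pos) (auto simp: n)
    then have "s (Suc (Suc k)) / s (Suc k) + s k / s (Suc k) = 2 * cos (pi / real n)"
      using s_rec[of k] by (simp add: field_simps)
    then show "s (Suc (Suc k)) / s (Suc k) * (z (Suc k))\<^sup>2 + s k / s (Suc k) * (z (Suc k))\<^sup>2 =
        2 * cos (pi / real n) * (z (Suc k))\<^sup>2"
      by (metis distrib_right)
  qed simp
  finally have main: "(\<Sum>k<m. 2 * z (Suc k) * z (Suc (Suc k))) \<le>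
      2 * cos (pi / real n) * (\<Sum>k<Suc m. (z (Suc k))\<^sup>2)"
    by (simp only: sum_distrib_left)
  have sq: "(\<Sum>k<n. (z k)\<^sup>2) = (\<Sum>k<Suc m. (z (Suc k))\<^sup>2)"
    unfolding n by (subst sum.lessThan_Suc_shift) (simp add: assms)
  have cross: "(\<Sum>k<n. 2 * z k * z (Suc k)) = (\<Sum>k<m. 2 * z (Suc k) * z (Suc (Suc k)))"
    unfolding n by (subst sum.lessThan_Suc_shift) (use assms in \<open>simp add: n\<close>)
  have sq': "(\<Sum>k<n. (z (Suc k))\<^sup>2) = (\<Sum>k<Suc m. (z (Suc k))\<^sup>2)"
    using assms by (simp add: n)
  have "(\<Sum>k<n. (z (Suc k) - z k)\<^sup>2) =
      (\<Sum>k<n. (z (Suc k))\<^sup>2) + (\<Sum>k<n. (z k)\<^sup>2) - (\<Sum>k<n. 2 * z k * z (Suc k))"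
    unfolding sum.distrib[symmetric] sum_subtractf[symmetric]
    by (intro sum.cong refl) (simp add: power2_eq_square algebra_simps)
  then show ?thesis using main unfolding sq sq' cross by (simp add: algebra_simps)
qed

lemma cos_pi_over_lt_1: "2 \<le> n \<Longrightarrow> cos (pi / real n) < 1"
  using cos_monotone_0_pi[of 0 "pi / real n"] by (simp add: field_simps)

text \<open>
  Reduction to functions that vanish at both ends: the partial sums \<open>z\<close> of \<open>y\<close> do, and \<open>y\<close> is
  their difference sequence. Summation by parts gives \<open>|y|\<^sup>2 = \<langle>z, -\<Delta>y\<rangle>\<close>, and the previous inequality
  bounds \<open>|z|\<^sup>2\<close> by \<open>|y|\<^sup>2\<close>, so \<open>y\<close> is bounded by \<open>\<Delta>y\<close>.
\<close>

lemma path_poincare: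
  fixes y :: "nat \<Rightarrow> real"
  assumes sum0: "(\<Sum>k<n. y k) = 0" and n: "2 \<le> n"
  shows "(2 - 2 * cos (pi / real n)) * (\<Sum>k<n. (y k)\<^sup>2) \<le> (\<Sum>k<n - 1. (y k - y (Suc k))\<^sup>2)"
proof -
  define l where "l = 2 - 2 * cos (pi / real n)"
  have l: "0 < l" using cos_pi_over_lt_1[OF n] by (simp add: l_def)
  define z where "z k = (\<Sum>j<k. y j)" for k
  obtain m where m: "n = Suc m" using n by (cases n) auto
  have parts: "(\<Sum>k<Suc j. (y k)\<^sup>2) = z (Suc j) * y j + (\<Sum>k<j. z (Suc k) * (y k - y (Suc k)))" for j
    by (induction j) (simp_all add: z_def power2_eq_square algebra_simps)
  have "2 * (\<Sum>k<n. (y k)\<^sup>2) = (\<Sum>k<m. 2 * z (Suc k) * (y k - y (Suc k)))"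
    using sum0 parts[of m] by (simp add: m z_def[of "Suc m"] sum_distrib_left mult.assoc)
  also have "\<dots> \<le> (\<Sum>k<m. l * (z (Suc k))\<^sup>2 + (y k - y (Suc k))\<^sup>2 / l)"
  proof (rule sum_mono)
    fix k
    have "0 \<le> (l * z (Suc k) - (y k - y (Suc k)))\<^sup>2 / l" using l by simp
    also have "\<dots> = l * (z (Suc k))\<^sup>2 + (y k - y (Suc k))\<^sup>2 / l - 2 * z (Suc k) * (y k - y (Suc k))"
      using l by (simp add: field_simps power2_eq_square)
    finally show "2 * z (Suc k) * (y k - y (Suc k)) \<le> l * (z (Suc k))\<^sup>2 + (y k - y (Suc k))\<^sup>2 / l"
      by simp
  qed
  also have "\<dots> = l * (\<Sum>k<m. (z (Suc k))\<^sup>2) + (\<Sum>k<m. (y k - y (Suc k))\<^sup>2) / l"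
    by (simp add: sum.distrib sum_distrib_left sum_divide_distrib)
  also have "(\<Sum>k<m. (z (Suc k))\<^sup>2) = (\<Sum>k<n. (z k)\<^sup>2)"
    unfolding m by (subst sum.lessThan_Suc_shift) (simp add: z_def)
  also have "l * (\<Sum>k<n. (z k)\<^sup>2) \<le> (\<Sum>k<n. (z (Suc k) - z k)\<^sup>2)"
    unfolding l_def by (rule path_poincare_dirichlet) (use n sum0 in \<open>auto simp: z_def\<close>)
  also have "\<dots> = (\<Sum>k<n. (y k)\<^sup>2)" by (simp add: z_def)
  finally have "(\<Sum>k<n. (y k)\<^sup>2) \<le> (\<Sum>k<m. (y k - y (Suc k))\<^sup>2) / l" by simp
  then have "l * (\<Sum>k<n. (y k)\<^sup>2) \<le> (\<Sum>k<m. (y k - y (Suc k))\<^sup>2)"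
    using l by (simp add: pos_le_divide_eq mult.commute)
  then show ?thesis by (simp add: m l_def)
qed

text \<open>
  The cosines sampled at the midpoints form the eigenvector that attains the preceding bound; the
  midpoints make the sequence symmetric about both ends, so that the boundary terms of the summation by
  parts vanish.
\<close>

lemma path_cosine_energy:
  assumes "1 \<le> n"
  defines "g \<equiv> \<lambda>k. cos (pi * (real k + 1 / 2) / real n)"
  shows "(\<Sum>k<n - 1. (g k - g (Suc k))\<^sup>2) = (2 - 2 * cos (pi / real n)) * (\<Sum>k<n. (g k)\<^sup>2)"
proof -
  define h where "h = pi / real n"
  \<comment> \<open>The samples \<open>g\<close> shifted by one place, to reach the value just before the first vertex
    with a natural number as index.\<close>
  define c where "c k = cos (h * (real k - 1 / 2))" for k
  have gc: "g k = c (Suc k)" for k by (simp add: g_def c_def h_def field_simps)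
  have rec: "c (Suc (Suc k)) + c k = 2 * cos h * c (Suc k)" for k
  proof -
    define t where "t = h * (real (Suc k) - 1 / 2)"
    have "c (Suc (Suc k)) = cos (t + h)" "c (Suc k) = cos t" "c k = cos (t - h)"
      by (simp_all add: c_def t_def algebra_simps)
    then show ?thesis by (simp add: cos_add cos_diff)
  qed
  have sbp: "(\<Sum>k<m. (c (Suc k) - c (Suc (Suc k)))\<^sup>2) + c 1 * (c 1 - c 0) +
      c (Suc m) * (c (Suc m) - c (Suc (Suc m))) = (2 - 2 * cos h) * (\<Sum>k<Suc m. (c (Suc k))\<^sup>2)" for m
  proof (induction m)
    case 0
    have "c 1 * (c 1 - c 0) + c 1 * (c 1 - c 2) = c 1 * (2 * c 1 - (c 2 + c 0))"
      by (simp add: algebra_simps)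
    also have "c 2 + c 0 = 2 * cos h * c 1" using rec[of 0] by (simp add: numeral_2_eq_2)
    finally show ?case by (simp add: algebra_simps power2_eq_square numeral_2_eq_2)
  next
    case (Suc m)
    have "c (Suc (Suc m)) * (2 * c (Suc (Suc m)) - (c (Suc (Suc (Suc m))) + c (Suc m)))
       = (2 - 2 * cos h) * (c (Suc (Suc m)))\<^sup>2"
      unfolding rec by (simp add: algebra_simps power2_eq_square)
    with Suc show ?case by (simp add: algebra_simps power2_eq_square)
  qed
  obtain m where m: "n = Suc m" using assms(1) by (cases n) auto
  have "c 0 = c 1" by (simp add: c_def)
  moreover have "c (Suc m) = c (Suc (Suc m))"
  proof -
    have h: "h * real n = pi" using m by (simp add: h_def)
    have "c (Suc m) = cos (h * real n - h / 2)" by (simp add: c_def m algebra_simps)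
    moreover have "c (Suc (Suc m)) = cos (h * real n + h / 2)"
      by (simp add: c_def m algebra_simps)
    ultimately show ?thesis by (simp add: h cos_add cos_diff)
  qed
  ultimately show ?thesis
    using sbp[of m] unfolding gc by (simp add: m h_def)
qed

section \<open>Dirichlet energy and the spectral gap\<close>

text \<open>
  Every edge is a pair of opposite arcs, which accounts for the factor \<open>1 / 2\<close>.
\<close>

definition dirichlet_energy :: "('a \<times> 'a) set \<Rightarrow> ('a \<Rightarrow> real) \<Rightarrow> real" where
  "dirichlet_energy E x = (\<Sum>(u, v)\<in>E. (x u - x v)\<^sup>2) / 2"

text \<open>
  Connectedness is stated through cuts because that is how both uses need it: an energy that vanishes
  forces a constant function, and no initial segment of a vertex ordering is isolated.
\<close>

locale connected_regular_arcs =
  fixes N :: nat and E :: "(nat \<times> nat) set" and d :: nat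
  assumes arcs_subset: "E \<subseteq> {..<N} \<times> {..<N}"
    and arcs_sym: "(u, v) \<in> E \<Longrightarrow> (v, u) \<in> E"
    and regular: "u < N \<Longrightarrow> card {v. (u, v) \<in> E} = d"
    and connected: "S \<subseteq> {..<N} \<Longrightarrow> S \<noteq> {} \<Longrightarrow> S \<noteq> {..<N} \<Longrightarrow> \<exists>u\<in>S. \<exists>v\<in>{..<N} - S. (u, v) \<in> E"
begin

lemma finite_arcs: "finite E"
  using arcs_subset by (rule finite_subset) auto

lemma finite_neighbours: "finite {v. (u, v) \<in> E}"
  by (rule finite_subset[of _ "{..<N}"]) (use arcs_subset in auto)

lemma sum_arcs: "(\<Sum>(u, v)\<in>E. f u v) = (\<Sum>u<N. \<Sum>v | (u, v) \<in> E. f u v)"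
proof -
  have "E = (SIGMA u:{..<N}. {v. (u, v) \<in> E})" using arcs_subset by auto
  then have "(\<Sum>(u, v)\<in>E. f u v) = (\<Sum>(u, v)\<in>(SIGMA u:{..<N}. {v. (u, v) \<in> E}). f u v)" by simp
  also have "\<dots> = (\<Sum>u<N. \<Sum>v | (u, v) \<in> E. f u v)"
    by (rule sum.Sigma[symmetric]) (auto simp: finite_neighbours)
  finally show ?thesis .
qed

lemma sum_arcs_swap: "(\<Sum>(u, v)\<in>E. f v u) = (\<Sum>(u, v)\<in>E. f u v)"
  by (rule sum.reindex_bij_witness[of _ prod.swap prod.swap]) (auto intro: arcs_sym)

lemma energy_eq:
  "dirichlet_energy E x =
     real d * (\<Sum>u<N. (x u)\<^sup>2) - (\<Sum>u<N. \<Sum>v<N. (if (u, v) \<in> E then 1 else 0) * x u * x v)"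
proof -
  have tails: "(\<Sum>(u, v)\<in>E. (x u)\<^sup>2) = real d * (\<Sum>u<N. (x u)\<^sup>2)"
    unfolding sum_arcs by (simp add: regular sum_distrib_left)
  have "(\<Sum>(u, v)\<in>E. x u * x v) = (\<Sum>u<N. \<Sum>v<N. (if (u, v) \<in> E then 1 else 0) * x u * x v)"
    unfolding sum_arcs
  proof (rule sum.cong)
    fix u
    have "(\<Sum>v | (u, v) \<in> E. x u * x v) = (\<Sum>v\<in>{..<N} \<inter> {v. (u, v) \<in> E}. x u * x v)"
      by (rule sum.cong) (use arcs_subset in auto)
    then show "(\<Sum>v | (u, v) \<in> E. x u * x v) =
        (\<Sum>v<N. (if (u, v) \<in> E then 1 else 0) * x u * x v)"
      by (simp add: sum.inter_restrict if_distrib[where f = "\<lambda>c. c * _ * _"] cong: if_cong)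
  qed simp
  moreover have "2 * dirichlet_energy E x =
      (\<Sum>(u, v)\<in>E. (x u)\<^sup>2) + (\<Sum>(u, v)\<in>E. (x v)\<^sup>2) - 2 * (\<Sum>(u, v)\<in>E. x u * x v)"
    unfolding dirichlet_energy_def sum_distrib_left sum.distrib[symmetric] sum_subtractf[symmetric]
    by (simp add: sum.distrib[symmetric] sum_subtractf[symmetric])
       (intro sum.cong refl, auto simp: power2_eq_square algebra_simps)
  moreover have "(\<Sum>(u, v)\<in>E. (x v)\<^sup>2) = (\<Sum>(u, v)\<in>E. (x u)\<^sup>2)" by (rule sum_arcs_swap)
  ultimately show ?thesis using tails by simp
qed

lemma energy_nonneg: "0 \<le> dirichlet_energy E x"
  unfolding dirichlet_energy_def by (auto intro!: sum_nonneg)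

lemma energy_zero_imp_constant:
  assumes "dirichlet_energy E x = 0" "u < N"
  shows "x u = x 0"
proof -
  define S where "S = {u. u < N \<and> x u = x 0}"
  have zero: "x u = x v" if "(u, v) \<in> E" for u v
  proof -
    have "(\<Sum>(u, v)\<in>E. (x u - x v)\<^sup>2) = 0" using assms(1) by (simp add: dirichlet_energy_def)
    then have "\<forall>p\<in>E. (case p of (u, v) \<Rightarrow> (x u - x v)\<^sup>2) = 0"
      by (subst (asm) sum_nonneg_eq_0_iff) (auto simp: finite_arcs)
    with that show ?thesis by auto
  qed
  have "S = {..<N}"
  proof (rule ccontr)
    assume "S \<noteq> {..<N}"
    moreover have "S \<subseteq> {..<N}" "0 \<in> S" using assms(2) by (auto simp: S_def)
    ultimately obtain u v where "u \<in> S" "v \<in> {..<N} - S" "(u, v) \<in> E"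
      using connected[of S] by blast
    with zero show False by (auto simp: S_def)
  qed
  with assms(2) show ?thesis by (auto simp: S_def)
qed

definition arc_matrix :: "real mat" where
  "arc_matrix = mat N N (\<lambda>(i, j). if (i, j) \<in> E then 1 else 0)"

text \<open>
  The energy of \<open>x\<close> is \<open>\<Sum> (d - e\<^sub>i) c\<^sub>i\<^sup>2\<close> for the coordinates \<open>c\<^sub>i\<close> of \<open>x\<close> in the eigenbasis and
  the eigenvalues \<open>e\<^sub>0 \<ge> e\<^sub>1 \<ge> \<dots>\<close>. As it is nonnegative and vanishes for the constants,
  \<open>e\<^sub>0 = d\<close>, and the first eigenvector has energy 0, so it is constant by connectedness. Thus sum 0
  means \<open>c\<^sub>0 = 0\<close>; all other coefficients are at least \<open>d - e\<^sub>1\<close>, with equality for the second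
  eigenvector, the witness \<open>w\<close>.
\<close>

lemma adjacency_spectral_gap:
  assumes N: "2 \<le> N"
  obtains w where "(\<Sum>u<N. w u) = 0" "(\<Sum>u<N. (w u)\<^sup>2) = 1"
    "dirichlet_energy E w = eigenvalues_desc arc_matrix ! 0 - eigenvalues_desc arc_matrix ! 1"
    "\<And>x. (\<Sum>u<N. x u) = 0 \<Longrightarrow>
      (eigenvalues_desc arc_matrix ! 0 - eigenvalues_desc arc_matrix ! 1) * (\<Sum>u<N. (x u)\<^sup>2) \<le> dirichlet_energy E x"
proof -
  let ?e = "\<lambda>i. eigenvalues_desc arc_matrix ! i"
  have A: "arc_matrix \<in> carrier_mat N N" by (simp add: arc_matrix_def)
  have sym: "transpose_mat arc_matrix = arc_matrix"
    by (rule eq_matI) (auto simp: arc_matrix_def intro: arcs_sym)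
  obtain v :: "nat \<Rightarrow> nat \<Rightarrow> real" where
    "length (eigenvalues_desc arc_matrix) = N" and
    mono: "\<And>i j. i \<le> j \<Longrightarrow> j < N \<Longrightarrow> ?e j \<le> ?e i" and
    orth: "\<And>i j. i < N \<Longrightarrow> j < N \<Longrightarrow> (\<Sum>a<N. v i a * v j a) = (if i = j then 1 else 0)" and
    parseval: "\<And>x. (\<Sum>a<N. (x a)\<^sup>2) = (\<Sum>i<N. (\<Sum>a<N. v i a * x a)\<^sup>2)" and
    quad: "\<And>x. (\<Sum>a<N. \<Sum>b<N. arc_matrix $$ (a, b) * x a * x b) = (\<Sum>i<N. ?e i * (\<Sum>a<N. v i a * x a)\<^sup>2)"
    by (rule symmetric_real_mat_eigenvalues_desc[OF A sym]) (rule that)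
  have energy: "dirichlet_energy E x = (\<Sum>i<N. (real d - ?e i) * (\<Sum>a<N. v i a * x a)\<^sup>2)" for x
  proof -
    have "(\<Sum>a<N. \<Sum>b<N. arc_matrix $$ (a, b) * x a * x b) =
        (\<Sum>u<N. \<Sum>v<N. (if (u, v) \<in> E then 1 else 0) * x u * x v)"
      by (intro sum.cong refl) (simp add: arc_matrix_def)
    then have "dirichlet_energy E x = real d * (\<Sum>i<N. (\<Sum>a<N. v i a * x a)\<^sup>2) -
        (\<Sum>i<N. ?e i * (\<Sum>a<N. v i a * x a)\<^sup>2)"
      by (simp only: energy_eq[of x] parseval[of x] flip: quad[of x])
    then show ?thesis by (simp only: sum_subtractf sum_distrib_left left_diff_distrib)
  qed
  have energy_v: "dirichlet_energy E (v j) = real d - ?e j" if "j < N" for j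
  proof -
    have "dirichlet_energy E (v j) = (\<Sum>i<N. if i = j then real d - ?e j else 0)"
      unfolding energy using that by (intro sum.cong refl) (auto simp: orth)
    then show ?thesis using that by simp
  qed
  have le_d: "?e j \<le> real d" if "j < N" for j
    using energy_nonneg[of "v j"] energy_v[OF that] by simp
  have norm_v: "(\<Sum>a<N. (v j a)\<^sup>2) = 1" if "j < N" for j
    using orth[OF that that] by (simp add: power2_eq_square)

  have e0: "?e 0 = real d"
  proof -
    have "dirichlet_energy E (\<lambda>_. 1) = 0" by (simp add: dirichlet_energy_def)
    then have "\<forall>i\<in>{..<N}. (real d - ?e i) * (\<Sum>a<N. v i a * 1)\<^sup>2 = 0"
      unfolding energy by (subst (asm) sum_nonneg_eq_0_iff) (auto simp: le_d)
    moreover have "\<exists>i<N. (\<Sum>a<N. v i a * 1)\<^sup>2 \<noteq> 0"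
    proof (rule ccontr)
      assume "\<not> ?thesis"
      then have "(\<Sum>i<N. (\<Sum>a<N. v i a * 1)\<^sup>2) = 0" by simp
      with parseval[of "\<lambda>_. 1"] N show False by simp
    qed
    ultimately obtain i where "i < N" "(real d - ?e i) * (\<Sum>a<N. v i a * 1)\<^sup>2 = 0"
        "(\<Sum>a<N. v i a * 1)\<^sup>2 \<noteq> 0" by blast
    then have "i < N" "?e i = real d" by auto
    with mono[of 0 i] le_d[of 0] N show ?thesis by auto
  qed
  define k where "k = v 0 0"
  have v0: "v 0 a = k" if "a < N" for a
    using energy_zero_imp_constant[of "v 0", OF _ that] energy_v[of 0] e0 N by (simp add: k_def)
  have "k \<noteq> 0"
  proof
    assume "k = 0"
    with v0 have "(\<Sum>a<N. (v 0 a)\<^sup>2) = 0" by simp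
    with norm_v[of 0] N show False by simp
  qed
  have c0: "(\<Sum>a<N. v 0 a * x a) = k * (\<Sum>a<N. x a)" for x
    unfolding sum_distrib_left by (intro sum.cong refl) (simp add: v0)
  show thesis
  proof
    show "(\<Sum>u<N. v 1 u) = 0" using orth[of 0 1] c0[of "v 1"] \<open>k \<noteq> 0\<close> N by simp
    show "(\<Sum>u<N. (v 1 u)\<^sup>2) = 1" using norm_v[of 1] N by simp
    show "dirichlet_energy E (v 1) = ?e 0 - ?e 1" using energy_v[of 1] N by (simp add: e0)
  next
    fix x :: "nat \<Rightarrow> real" assume x: "(\<Sum>u<N. x u) = 0"
    show "(?e 0 - ?e 1) * (\<Sum>u<N. (x u)\<^sup>2) \<le> dirichlet_energy E x"
      unfolding energy[of x] parseval[of x] sum_distrib_left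
    proof (rule sum_mono)
      fix i assume "i \<in> {..<N}"
      then show "(?e 0 - ?e 1) * (\<Sum>a<N. v i a * x a)\<^sup>2 \<le> (real d - ?e i) * (\<Sum>a<N. v i a * x a)\<^sup>2"
        using mono[of 1 i] c0[of x] x by (cases "i = 0") (auto simp: e0 intro!: mult_right_mono)
    qed
  qed
qed

end

section \<open>Cuts of cubic bipartite graphs and the lower bound\<close>

text \<open>
  Expand the square of \<open>y u - y v\<close> as a sum of steps and drop the products of steps that are not
  neighbours, which are nonnegative.
\<close>

lemma square_sum_nonneg_steps_ge:
  fixes y :: "nat \<Rightarrow> real"
  assumes "u < v" and "\<And>i. i < v \<Longrightarrow> y (Suc i) \<le> y i"
  shows "(\<Sum>i\<in>{u..<v}. (y i - y (Suc i))\<^sup>2)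
      + 2 * (\<Sum>i\<in>{u..<v - 1}. (y i - y (Suc i)) * (y (Suc i) - y (Suc (Suc i)))) \<le> (y u - y v)\<^sup>2"
proof -
  from assms(1) have "Suc u \<le> v" by simp
  then show ?thesis using assms(2)
  proof (induction v rule: dec_induct)
    case base
    then show ?case by simp
  next
    case (step v)
    then obtain w where w: "v = Suc w" "u \<le> w" by (cases v) auto
    have "y j \<le> y u" if "u \<le> j" "j \<le> v" for j
      using that
    proof (induction j rule: dec_induct)
      case (step j)
      then have "y (Suc j) \<le> y j" using \<open>\<And>i. i < Suc v \<Longrightarrow> y (Suc i) \<le> y i\<close> by simp
      with step show ?case by simp
    qed simp
    then have "y w \<le> y u" using w by simp
    moreover have "y (Suc v) \<le> y v" using step.prems[of v] by simp
    ultimately have "(y w - y v) * (y v - y (Suc v)) \<le> (y u - y v) * (y v - y (Suc v))"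
      by (intro mult_right_mono) auto
    moreover have "(y u - y (Suc v))\<^sup>2 =
        (y u - y v)\<^sup>2 + (y v - y (Suc v))\<^sup>2 + 2 * ((y u - y v) * (y v - y (Suc v)))"
      by (simp add: power2_eq_square algebra_simps)
    moreover have "(\<Sum>i\<in>{u..<v}. (y i - y (Suc i))\<^sup>2)
      + 2 * (\<Sum>i\<in>{u..<v - 1}. (y i - y (Suc i)) * (y (Suc i) - y (Suc (Suc i)))) \<le> (y u - y v)\<^sup>2"
      by (rule step.IH) (use step.prems in auto)
    ultimately show ?case using w by (simp add: algebra_simps)
  qed
qed

text \<open>
  The bipartition is a colouring by truth values, which makes relabelling the vertices a composition of
  functions.
\<close>

locale connected_cubic_bipartite_arcs = connected_regular_arcs "2 * n" E 3 for n E +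
  fixes col :: "nat \<Rightarrow> bool"
  assumes bicoloured: "(u, v) \<in> E \<Longrightarrow> col u \<noteq> col v"
begin

definition cut :: "nat set \<Rightarrow> (nat \<times> nat) set" where
  "cut S = {(u, v) \<in> E. u \<in> S \<and> v \<notin> S}"

lemma finite_cut [simp]: "finite (cut S)"
  unfolding cut_def by (rule finite_subset[OF _ finite_arcs]) auto

lemma card_arcs_from: "T \<subseteq> {..<2 * n} \<Longrightarrow> card {(u, v) \<in> E. u \<in> T} = 3 * card T"
proof -
  assume T: "T \<subseteq> {..<2 * n}"
  then have fin: "finite T" by (rule finite_subset) simp
  have "{(u, v) \<in> E. u \<in> T} = (SIGMA u:T. {v. (u, v) \<in> E})" by auto
  then have "card {(u, v) \<in> E. u \<in> T} = (\<Sum>u\<in>T. card {v. (u, v) \<in> E})"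
    using fin by (simp add: card_SigmaI finite_neighbours)
  also have "\<dots> = (\<Sum>u\<in>T. 3)" by (rule sum.cong) (use T regular in auto)
  finally show ?thesis by simp
qed

text \<open>
  Count the arcs that start in \<open>S\<close> by the colour of their tail. The arcs that stay in \<open>S\<close> are equally
  many for both colours, by reversal. So if \<open>b\<close> and \<open>w\<close> are the numbers of vertices and \<open>p\<close> and \<open>q\<close>
  those of leaving arcs of the two colours, then \<open>p - q = 3 (b - w)\<close>. This excludes \<open>p + q = 1\<close>,
  connectedness excludes 0, and \<open>p + q\<close> has the parity of \<open>b + w\<close>, the size of \<open>S\<close>.
\<close>

lemma card_cut_ge:
  assumes S: "S \<subseteq> {..<2 * n}" "S \<noteq> {}" "S \<noteq> {..<2 * n}"
  shows "2 \<le> card (cut S)" and "odd (card S) \<Longrightarrow> 3 \<le> card (cut S)"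
proof -
  define B W where "B = {u \<in> S. col u}" and "W = {u \<in> S. \<not> col u}"
  define out where "out T = {(u, v) \<in> E. u \<in> T \<and> v \<notin> S}" for T
  define ins where "ins T = {(u, v) \<in> E. u \<in> T \<and> v \<in> S}" for T
  have fin: "finite (out T)" "finite (ins T)" for T
    unfolding out_def ins_def by (rule finite_subset[OF _ finite_arcs]; auto)+
  have count: "card (out T) + card (ins T) = 3 * card T" if "T \<subseteq> S" for T
  proof -
    have "{(u, v) \<in> E. u \<in> T} = out T \<union> ins T" by (auto simp: out_def ins_def)
    moreover have "card (out T \<union> ins T) = card (out T) + card (ins T)"
      by (rule card_Un_disjoint[OF fin]) (auto simp: out_def ins_def)
    moreover have "T \<subseteq> {..<2 * n}" using that S(1) by auto
    ultimately show ?thesis using card_arcs_from[of T] by simp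
  qed
  have "card (ins B) = card (ins W)"
  proof (rule bij_betw_same_card)
    have "(u, v) \<in> ins B \<longleftrightarrow> (v, u) \<in> ins W" for u v
      using arcs_sym[of u v] arcs_sym[of v u] bicoloured[of u v] bicoloured[of v u]
      by (auto simp: ins_def B_def W_def)
    then show "bij_betw prod.swap (ins B) (ins W)"
      by (intro bij_betwI[of _ _ _ prod.swap]) auto
  qed
  moreover have "card (cut S) = card (out B) + card (out W)"
  proof -
    have "cut S = out B \<union> out W" by (auto simp: out_def B_def W_def cut_def)
    moreover have "out B \<inter> out W = {}" by (auto simp: out_def B_def W_def)
    ultimately show ?thesis using card_Un_disjoint[OF fin(1) fin(1)] by simp
  qed
  moreover have cardS: "card S = card B + card W"
  proof -
    have "finite S" using S(1) by (rule finite_subset) simp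
    then have "card (B \<union> W) = card B + card W"
      by (intro card_Un_disjoint) (auto simp: B_def W_def)
    moreover have "B \<union> W = S" by (auto simp: B_def W_def)
    ultimately show ?thesis by simp
  qed
  moreover have "card (out B) + card (ins B) = 3 * card B" "card (out W) + card (ins W) = 3 * card W"
    by (rule count; auto simp: B_def W_def)+
  moreover have "0 < card (cut S)"
    using connected[OF S] by (auto simp: card_gt_0_iff) (auto simp: cut_def)
  moreover have "2 \<le> p + q \<and> (odd (b + w) \<longrightarrow> 3 \<le> p + q)"
    if "p + r = 3 * b" "q + r = 3 * w" "0 < p + q" for p q r b w :: nat
  proof -
    have "p + 3 * w = q + 3 * b" using that by simp
    then show ?thesis using \<open>0 < p + q\<close> by presburger
  qed
  ultimately have "2 \<le> card (cut S) \<and> (odd (card B + card W) \<longrightarrow> 3 \<le> card (cut S))"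
    by simp
  then show "2 \<le> card (cut S)" and "odd (card S) \<Longrightarrow> 3 \<le> card (cut S)"
    using cardS by simp_all
qed

lemma cut_initial_segment: "cut {..i} = {(u, v) \<in> E. u \<le> i \<and> i < v}"
  by (auto simp: cut_def)

lemma card_initial_cut_ge:
  assumes "Suc i < 2 * n"
  shows "2 \<le> card (cut {..i})" and "even i \<Longrightarrow> 3 \<le> card (cut {..i})"
proof -
  have "{..i} \<subseteq> {..<2 * n}" "{..i} \<noteq> {}" using assms by auto
  moreover have "Suc i \<in> {..<2 * n} - {..i}" using assms by auto
  then have "{..i} \<noteq> {..<2 * n}" by blast
  ultimately show "2 \<le> card (cut {..i})" and "even i \<Longrightarrow> 3 \<le> card (cut {..i})"
    using card_cut_ge[of "{..i}"] by auto
qed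

text \<open>
  Of the three edges at vertex \<open>i + 1\<close>, those to earlier vertices lie in the first cut only and those to
  later vertices in the second only; all other edges of the two cuts are common to both.
\<close>

lemma card_consecutive_cuts:
  assumes "Suc i < 2 * n"
  shows "card (cut {..i}) + card (cut {..Suc i}) = 2 * card (cut {..i} \<inter> cut {..Suc i}) + 3"
proof -
  define w where "w = Suc i"
  define L R where "L = {u. (w, u) \<in> E \<and> u \<le> i}" and "R = {v. (w, v) \<in> E \<and> w < v}"
  have fin: "finite L" "finite R"
    unfolding L_def R_def by (rule finite_subset[OF _ finite_neighbours[of w]]; auto)+
  have "v \<le> i \<or> w < v" if "(w, v) \<in> E" for v
  proof -
    have "v \<noteq> w" using bicoloured that by blast
    then show ?thesis by (auto simp: w_def)
  qed
  then have "{v. (w, v) \<in> E} = L \<union> R" "L \<inter> R = {}" by (auto simp: L_def R_def w_def)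
  then have LR: "card L + card R = 3"
    using regular[of w] assms fin by (simp add: w_def card_Un_disjoint)
  have "(u, v) \<in> cut {..i} \<longleftrightarrow> (u, v) \<in> (cut {..i} \<inter> cut {..w}) \<union> (\<lambda>u. (u, w)) ` L" for u v
    using arcs_sym[of u v] arcs_sym[of v u]
    by (cases "v = w") (auto simp: cut_initial_segment L_def w_def)
  then have "cut {..i} = (cut {..i} \<inter> cut {..w}) \<union> (\<lambda>u. (u, w)) ` L"
    by (intro equalityI subrelI) blast+
  moreover have "(cut {..i} \<inter> cut {..w}) \<inter> (\<lambda>u. (u, w)) ` L = {}"
    unfolding cut_initial_segment by (auto simp: w_def)
  ultimately have "card (cut {..i}) = card (cut {..i} \<inter> cut {..w}) + card ((\<lambda>u. (u, w)) ` L)"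
    using fin card_Un_disjoint[of "cut {..i} \<inter> cut {..w}" "(\<lambda>u. (u, w)) ` L"] by simp
  moreover have "cut {..w} = (cut {..i} \<inter> cut {..w}) \<union> Pair w ` R"
    unfolding cut_initial_segment R_def by (auto simp: w_def le_Suc_eq)
  moreover have "(cut {..i} \<inter> cut {..w}) \<inter> Pair w ` R = {}"
    unfolding cut_initial_segment by (auto simp: w_def)
  ultimately have "card (cut {..w}) = card (cut {..i} \<inter> cut {..w}) + card (Pair w ` R)"
    using fin card_Un_disjoint[of "cut {..i} \<inter> cut {..w}" "Pair w ` R"] by simp
  moreover note \<open>card (cut {..i}) = card (cut {..i} \<inter> cut {..w}) + card ((\<lambda>u. (u, w)) ` L)\<close>
  moreover have "card ((\<lambda>u. (u, w)) ` L) = card L" "card (Pair w ` R) = card R"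
    by (auto intro!: card_image inj_onI)
  ultimately show ?thesis using LR by (simp add: w_def)
qed

text \<open>
  Bound every edge by the preceding expansion and exchange the order of summation: step \<open>i\<close> occurs in the
  edges of the \<open>i\<close>-th cut, and a product of two neighbouring steps in the edges common to two cuts.
\<close>

lemma energy_ge_cut_sums:
  fixes y :: "nat \<Rightarrow> real"
  assumes mono: "\<And>i. Suc i < 2 * n \<Longrightarrow> y (Suc i) \<le> y i"
  shows "(\<Sum>i<2 * n - 1. real (card (cut {..i})) * (y i - y (Suc i))\<^sup>2)
     + 2 * (\<Sum>i<2 * n - 2. real (card (cut {..i} \<inter> cut {..Suc i})) *
          ((y i - y (Suc i)) * (y (Suc i) - y (Suc (Suc i))))) \<le> dirichlet_energy E y"
proof -
  define s where "s i = (y i - y (Suc i))\<^sup>2" for i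
  define t where "t i = (y i - y (Suc i)) * (y (Suc i) - y (Suc (Suc i)))" for i
  define F where "F = {(u, v) \<in> E. u < v}"
  have finF: "finite F" unfolding F_def by (rule finite_subset[OF _ finite_arcs]) auto
  have energy: "dirichlet_energy E y = (\<Sum>(u, v)\<in>F. (y u - y v)\<^sup>2)"
  proof -
    have E: "E = F \<union> prod.swap ` F" "F \<inter> prod.swap ` F = {}"
    proof -
      have "p \<in> F \<union> prod.swap ` F" if "p \<in> E" for p
      proof (cases p)
        case (Pair u v)
        with that bicoloured[of u v] have "u \<noteq> v" by auto
        then show ?thesis using that Pair arcs_sym by (cases "u < v") (force simp: F_def)+
      qed
      then show "E = F \<union> prod.swap ` F" using arcs_sym by (auto simp: F_def)
    qed (auto simp: F_def)
    have "(\<Sum>(u, v)\<in>E. (y u - y v)\<^sup>2) =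
        (\<Sum>(u, v)\<in>F. (y u - y v)\<^sup>2) + (\<Sum>(u, v)\<in>prod.swap ` F. (y u - y v)\<^sup>2)"
      by (subst E(1), rule sum.union_disjoint) (use finF E in auto)
    also have "(\<Sum>(u, v)\<in>prod.swap ` F. (y u - y v)\<^sup>2) = (\<Sum>(u, v)\<in>F. (y u - y v)\<^sup>2)"
      by (subst sum.reindex) (auto simp: case_prod_unfold power2_commute)
    finally show ?thesis by (simp add: dirichlet_energy_def)
  qed
  have "(\<Sum>(u, v)\<in>F. (\<Sum>i<2 * n - 1. if u \<le> i \<and> i < v then s i else 0)
      + 2 * (\<Sum>i<2 * n - 2. if u \<le> i \<and> Suc i < v then t i else 0)) \<le> dirichlet_energy E y"
    unfolding energy
  proof (rule sum_mono, clarify)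
    fix u v assume "(u, v) \<in> F"
    then have uv: "u < v" "v < 2 * n" using arcs_subset by (auto simp: F_def)
    have "(\<Sum>i<2 * n - 1. if u \<le> i \<and> i < v then s i else 0) = (\<Sum>i\<in>{u..<v}. s i)"
      by (rule sum.mono_neutral_cong_right) (use uv in auto)
    moreover have "(\<Sum>i<2 * n - 2. if u \<le> i \<and> Suc i < v then t i else 0) = (\<Sum>i\<in>{u..<v - 1}. t i)"
      by (rule sum.mono_neutral_cong_right) (use uv in auto)
    ultimately show "(\<Sum>i<2 * n - 1. if u \<le> i \<and> i < v then s i else 0)
      + 2 * (\<Sum>i<2 * n - 2. if u \<le> i \<and> Suc i < v then t i else 0) \<le> (y u - y v)\<^sup>2"
      using square_sum_nonneg_steps_ge[of u v y] uv mono by (simp add: s_def t_def)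
  qed
  also have "(\<Sum>(u, v)\<in>F. (\<Sum>i<2 * n - 1. if u \<le> i \<and> i < v then s i else 0)
      + 2 * (\<Sum>i<2 * n - 2. if u \<le> i \<and> Suc i < v then t i else 0)) =
      (\<Sum>i<2 * n - 1. \<Sum>p\<in>F. if p \<in> cut {..i} then s i else 0)
      + 2 * (\<Sum>i<2 * n - 2. \<Sum>p\<in>F. if p \<in> cut {..i} \<inter> cut {..Suc i} then t i else 0)"
  proof -
    have 1: "(\<Sum>i<2 * n - 1. if u \<le> i \<and> i < v then s i else 0) =
        (\<Sum>i<2 * n - 1. if (u, v) \<in> cut {..i} then s i else 0)" if "(u, v) \<in> F" for u v
      using that by (intro sum.cong) (auto simp: cut_initial_segment F_def)
    have 2: "(\<Sum>i<2 * n - 2. if u \<le> i \<and> Suc i < v then t i else 0) =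
        (\<Sum>i<2 * n - 2. if (u, v) \<in> cut {..i} \<inter> cut {..Suc i} then t i else 0)" if "(u, v) \<in> F" for u v
      using that by (intro sum.cong) (auto simp: cut_initial_segment F_def)
    have "(\<Sum>(u, v)\<in>F. (\<Sum>i<2 * n - 1. if u \<le> i \<and> i < v then s i else 0)
      + 2 * (\<Sum>i<2 * n - 2. if u \<le> i \<and> Suc i < v then t i else 0)) =
      (\<Sum>p\<in>F. (\<Sum>i<2 * n - 1. if p \<in> cut {..i} then s i else 0)
      + 2 * (\<Sum>i<2 * n - 2. if p \<in> cut {..i} \<inter> cut {..Suc i} then t i else 0))"
      by (intro sum.cong refl) (auto simp only: 1 2 split: prod.splits)
    moreover have "(\<Sum>p\<in>F. \<Sum>i<2 * n - 1. if p \<in> cut {..i} then s i else 0) =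
        (\<Sum>i<2 * n - 1. \<Sum>p\<in>F. if p \<in> cut {..i} then s i else 0)"
      by (rule sum.swap)
    moreover have "(\<Sum>p\<in>F. \<Sum>i<2 * n - 2. if p \<in> cut {..i} \<inter> cut {..Suc i} then t i else 0) =
        (\<Sum>i<2 * n - 2. \<Sum>p\<in>F. if p \<in> cut {..i} \<inter> cut {..Suc i} then t i else 0)"
      by (rule sum.swap)
    ultimately show ?thesis by (simp only: sum.distrib sum_distrib_left[symmetric])
  qed
  also have "\<dots> = (\<Sum>i<2 * n - 1. real (card (cut {..i})) * s i)
     + 2 * (\<Sum>i<2 * n - 2. real (card (cut {..i} \<inter> cut {..Suc i})) * t i)"
  proof -
    have "F \<inter> cut {..i} = cut {..i}" "F \<inter> (cut {..i} \<inter> cut {..Suc i}) = cut {..i} \<inter> cut {..Suc i}" for i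
      by (auto simp: cut_initial_segment F_def)
    then show ?thesis by (simp only: sum.inter_restrict[OF finF, symmetric]) simp
  qed
  finally show ?thesis unfolding s_def t_def .
qed

end

lemma sum_even_odd:
  fixes f :: "nat \<Rightarrow> real"
  shows "(\<Sum>i<2 * m. f i) = (\<Sum>k<m. f (2 * k) + f (Suc (2 * k)))"
  by (induction m) auto

context connected_cubic_bipartite_arcs
begin

text \<open>
  With \<open>b\<^sub>k = d\<^bsub>2k\<^esub>\<close> (within a pair) and \<open>a\<^sub>k = d\<^bsub>2k+1\<^esub>\<close> (between pairs) the means of the pairs satisfy
  \<open>h\<^sub>k - h\<^bsub>k+1\<^esub> = a\<^sub>k + (b\<^sub>k + b\<^bsub>k+1\<^esub>) / 2\<close>. The cut estimate
  \<open>\<Sum> 3 b\<^sub>k\<^sup>2 + \<Sum> 2 a\<^sub>k\<^sup>2 + 2 \<Sum> a\<^sub>k (b\<^sub>k + b\<^bsub>k+1\<^esub>)\<close> therefore exceeds \<open>2 \<Sum> (h\<^sub>k - h\<^bsub>k+1\<^esub>)\<^sup>2\<close> by at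
  least \<open>\<Sum> b\<^sub>k\<^sup>2\<close>, where two of the three copies of \<open>b\<^sub>k\<^sup>2\<close> pay for the mixed terms
  \<open>b\<^sub>k b\<^bsub>k+1\<^esub>\<close>. The copy that is left controls the part of \<open>|y|\<^sup>2 = 2 |h|\<^sup>2 + |b|\<^sup>2 / 2\<close> not seen by
  the means, because \<open>2 - 2 cos (\<pi> / n) \<le> 2\<close>.
\<close>

lemma energy_ge_sorted:
  fixes y :: "nat \<Rightarrow> real"
  assumes mono: "\<And>i. Suc i < 2 * n \<Longrightarrow> y (Suc i) \<le> y i"
    and sum0: "(\<Sum>u<2 * n. y u) = 0" and n: "2 \<le> n"
  shows "(2 - 2 * cos (pi / real n)) * (\<Sum>u<2 * n. (y u)\<^sup>2) \<le> dirichlet_energy E y"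
proof -
  define l where "l = 2 - 2 * cos (pi / real n)"
  obtain m where m: "n = Suc m" using n by (cases n) auto
  define d where "d i = y i - y (Suc i)" for i
  define b a h where "b k = d (2 * k)" and "a k = d (Suc (2 * k))"
    and "h k = (y (2 * k) + y (Suc (2 * k))) / 2" for k
  have d: "0 \<le> d i" if "Suc i < 2 * n" for i using mono[OF that] by (simp add: d_def)

  have l_le: "l \<le> 2"
  proof -
    have "pi / real n \<le> pi / 2" using n by (intro divide_left_mono) auto
    moreover have "0 \<le> pi / real n" by simp
    ultimately have "0 \<le> cos (pi / real n)" using pi_gt_zero by (intro cos_ge_zero) linarith+
    then show ?thesis by (simp add: l_def)
  qed

  have cut_sum: "(\<Sum>k<n. 3 * (b k)\<^sup>2) + (\<Sum>k<m. 2 * (a k)\<^sup>2) \<le>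
      (\<Sum>i<2 * n - 1. real (card (cut {..i})) * (d i)\<^sup>2)"
  proof -
    have "(\<Sum>k<n. 3 * (b k)\<^sup>2) + (\<Sum>k<m. 2 * (a k)\<^sup>2) =
        (\<Sum>i<2 * m. (if even i then 3 else 2) * (d i)\<^sup>2) + 3 * (d (2 * m))\<^sup>2"
      unfolding sum_even_odd by (simp add: m sum.distrib b_def a_def)
    also have "\<dots> = (\<Sum>i<2 * n - 1. (if even i then 3 else 2) * (d i)\<^sup>2)" by (simp add: m)
    also have "\<dots> \<le> (\<Sum>i<2 * n - 1. real (card (cut {..i})) * (d i)\<^sup>2)"
    proof (intro sum_mono mult_right_mono)
      fix i assume "i \<in> {..<2 * n - 1}"
      then have "Suc i < 2 * n" by auto
      from card_initial_cut_ge[OF this] show "(if even i then 3 else 2) \<le> real (card (cut {..i}))"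
        by auto
    qed simp
    finally show ?thesis .
  qed
  have pass_sum: "(\<Sum>k<m. a k * (b k + b (Suc k))) \<le>
      (\<Sum>i<2 * n - 2. real (card (cut {..i} \<inter> cut {..Suc i})) * (d i * d (Suc i)))"
  proof -
    have idx: "2 * n - 2 = 2 * m" by (simp add: m)
    have "(\<Sum>k<m. a k * (b k + b (Suc k))) = (\<Sum>i<2 * n - 2. 1 * (d i * d (Suc i)))"
      unfolding idx sum_even_odd by (simp add: a_def b_def algebra_simps)
    also have "\<dots> \<le> (\<Sum>i<2 * n - 2. real (card (cut {..i} \<inter> cut {..Suc i})) * (d i * d (Suc i)))"
    proof (intro sum_mono mult_right_mono)
      fix i assume "i \<in> {..<2 * n - 2}"
      then have i: "Suc (Suc i) < 2 * n" by auto
      then show "0 \<le> d i * d (Suc i)" by (simp add: d)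
      have "5 \<le> card (cut {..i}) + card (cut {..Suc i})"
        using card_initial_cut_ge[of i] card_initial_cut_ge[of "Suc i"] i by (cases "even i") auto
      then show "1 \<le> real (card (cut {..i} \<inter> cut {..Suc i}))"
        using card_consecutive_cuts[of i] i by simp
    qed
    finally show ?thesis .
  qed

  have h_step: "h k - h (Suc k) = a k + (b k + b (Suc k)) / 2" for k
    by (simp add: h_def a_def b_def d_def field_simps)
  have "(\<Sum>k<m. 2 * (h k - h (Suc k))\<^sup>2) + (\<Sum>k<n. (b k)\<^sup>2) \<le>
      (\<Sum>k<n. 3 * (b k)\<^sup>2) + (\<Sum>k<m. 2 * (a k)\<^sup>2) + 2 * (\<Sum>k<m. a k * (b k + b (Suc k)))"
  proof -
    have "(\<Sum>k<m. 2 * (h k - h (Suc k))\<^sup>2) \<le>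
        (\<Sum>k<m. 2 * (a k)\<^sup>2 + 2 * (a k * (b k + b (Suc k))) + ((b k)\<^sup>2 + (b (Suc k))\<^sup>2))"
    proof (rule sum_mono)
      fix k
      have "0 \<le> (b k - b (Suc k))\<^sup>2 / 2" by simp
      also have "\<dots> = 2 * (a k)\<^sup>2 + 2 * (a k * (b k + b (Suc k))) + ((b k)\<^sup>2 + (b (Suc k))\<^sup>2)
          - 2 * (h k - h (Suc k))\<^sup>2"
        unfolding h_step by (simp add: power2_eq_square field_simps)
      finally show "2 * (h k - h (Suc k))\<^sup>2 \<le>
          2 * (a k)\<^sup>2 + 2 * (a k * (b k + b (Suc k))) + ((b k)\<^sup>2 + (b (Suc k))\<^sup>2)" by simp
    qed
    also have "\<dots> = (\<Sum>k<m. 2 * (a k)\<^sup>2) + 2 * (\<Sum>k<m. a k * (b k + b (Suc k))) +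
        ((\<Sum>k<m. (b k)\<^sup>2) + (\<Sum>k<m. (b (Suc k))\<^sup>2))"
      by (simp only: sum.distrib sum_distrib_left)
    also have "(\<Sum>k<m. (b k)\<^sup>2) \<le> (\<Sum>k<n. (b k)\<^sup>2)" by (simp add: m)
    also have "(\<Sum>k<m. (b (Suc k))\<^sup>2) \<le> (\<Sum>k<n. (b k)\<^sup>2)"
      unfolding m by (subst sum.lessThan_Suc_shift) simp
    finally show ?thesis by (simp add: sum_distrib_left[symmetric])
  qed
  also have "\<dots> \<le> dirichlet_energy E y"
    using energy_ge_cut_sums[of y, OF mono] cut_sum pass_sum unfolding d_def[symmetric] by linarith
  finally have energy: "(\<Sum>k<m. 2 * (h k - h (Suc k))\<^sup>2) + (\<Sum>k<n. (b k)\<^sup>2) \<le> dirichlet_energy E y" .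

  have "(\<Sum>k<n. h k) = (\<Sum>u<2 * n. y u) / 2"
    unfolding sum_even_odd by (simp add: h_def sum_divide_distrib)
  then have "l * (\<Sum>k<n. (h k)\<^sup>2) \<le> (\<Sum>k<m. (h k - h (Suc k))\<^sup>2)"
    using path_poincare[where y = h and n = n] sum0 n unfolding l_def m by simp
  then have poincare: "l * (2 * (\<Sum>k<n. (h k)\<^sup>2)) \<le> (\<Sum>k<m. 2 * (h k - h (Suc k))\<^sup>2)"
    by (simp add: sum_distrib_left[symmetric])
  have "(\<Sum>u<2 * n. (y u)\<^sup>2) = 2 * (\<Sum>k<n. (h k)\<^sup>2) + (\<Sum>k<n. (b k)\<^sup>2) / 2"
    unfolding sum_even_odd sum_distrib_left sum_divide_distrib sum.distrib[symmetric]
    by (intro sum.cong refl) (simp add: h_def b_def d_def power2_eq_square field_simps)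
  then have "l * (\<Sum>u<2 * n. (y u)\<^sup>2) =
      l * (2 * (\<Sum>k<n. (h k)\<^sup>2)) + l / 2 * (\<Sum>k<n. (b k)\<^sup>2)" by (simp add: algebra_simps)
  also have "l / 2 * (\<Sum>k<n. (b k)\<^sup>2) \<le> 1 * (\<Sum>k<n. (b k)\<^sup>2)"
    using l_le by (intro mult_right_mono sum_nonneg) auto
  finally show ?thesis using poincare energy by (simp add: l_def)
qed

text \<open>
  All hypotheses are invariant under renaming the vertices; this reduces the estimate for an arbitrary
  function to decreasing ones.
\<close>

lemma relabel:
  assumes p: "bij_betw p {..<2 * n} {..<2 * n}"
  defines "E' \<equiv> {(i, j). i < 2 * n \<and> j < 2 * n \<and> (p i, p j) \<in> E}"
  shows "connected_cubic_bipartite_arcs n E' (col \<circ> p)"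
    and "dirichlet_energy E' (x \<circ> p) = dirichlet_energy E x"
proof -
  have p_lt: "p i < 2 * n" if "i < 2 * n" for i using bij_betwE[OF p] that by auto
  have inj: "inj_on p {..<2 * n}" and img: "p ` {..<2 * n} = {..<2 * n}"
    using p by (auto simp: bij_betw_def)
  have E_lt: "u < 2 * n" "v < 2 * n" if "(u, v) \<in> E" for u v using arcs_subset that by auto
  show "connected_cubic_bipartite_arcs n E' (col \<circ> p)"
  proof unfold_locales
    show "E' \<subseteq> {..<2 * n} \<times> {..<2 * n}" by (auto simp: E'_def)
    show "(v, u) \<in> E'" if "(u, v) \<in> E'" for u v using that arcs_sym by (auto simp: E'_def)
    show "(col \<circ> p) u \<noteq> (col \<circ> p) v" if "(u, v) \<in> E'" for u v
      using that bicoloured[of "p u" "p v"] by (auto simp: E'_def)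
    show "card {v. (u, v) \<in> E'} = 3" if u: "u < 2 * n" for u
    proof -
      have "p ` {v. (u, v) \<in> E'} = {v. (p u, v) \<in> E}"
      proof
        show "{v. (p u, v) \<in> E} \<subseteq> p ` {v. (u, v) \<in> E'}"
        proof
          fix v assume v: "v \<in> {v. (p u, v) \<in> E}"
          then have "v \<in> p ` {..<2 * n}" using E_lt img by auto
          with v u show "v \<in> p ` {v. (u, v) \<in> E'}" by (auto simp: E'_def)
        qed
      qed (auto simp: E'_def)
      moreover have "inj_on p {v. (u, v) \<in> E'}"
        by (rule inj_on_subset[OF inj]) (auto simp: E'_def)
      ultimately show ?thesis using regular[OF p_lt[OF u]] by (metis card_image)
    qed
    show "\<exists>u\<in>S. \<exists>v\<in>{..<2 * n} - S. (u, v) \<in> E'"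
      if S: "S \<subseteq> {..<2 * n}" "S \<noteq> {}" "S \<noteq> {..<2 * n}" for S
    proof -
      have "p ` S \<subseteq> {..<2 * n}" using S(1) p_lt by auto
      moreover have "p ` S \<noteq> {..<2 * n}"
        using S inj_on_image_eq_iff[OF inj S(1) order_refl] img by auto
      ultimately obtain u v where uv: "u \<in> p ` S" "v \<in> {..<2 * n} - p ` S" "(u, v) \<in> E"
        using connected[of "p ` S"] S(2) by blast
      then obtain i where i: "i \<in> S" "u = p i" by blast
      have "v \<in> p ` {..<2 * n}" using uv img by auto
      then obtain j where j: "j < 2 * n" "v = p j" by auto
      have "j \<notin> S" using uv j by auto
      then have "(i, j) \<in> E'" using i j uv(3) S(1) by (auto simp: E'_def)
      with i(1) j(1) \<open>j \<notin> S\<close> show ?thesis by blast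
    qed
  qed
  have "bij_betw (map_prod p p) E' E"
    unfolding bij_betw_def
  proof
    show "inj_on (map_prod p p) E'"
      by (rule inj_on_subset[OF map_prod_inj_on[OF inj inj]]) (auto simp: E'_def)
    have "(u, v) \<in> map_prod p p ` E'" if "(u, v) \<in> E" for u v
    proof -
      have "u \<in> p ` {..<2 * n}" "v \<in> p ` {..<2 * n}" using E_lt[OF that] img by auto
      then obtain i j where "i < 2 * n" "u = p i" "j < 2 * n" "v = p j" by auto
      then show ?thesis using that by (auto simp: E'_def intro!: image_eqI[of _ _ "(i, j)"])
    qed
    then show "map_prod p p ` E' = E" by (auto simp: E'_def)
  qed
  from sum.reindex_bij_betw[OF this, of "\<lambda>(u, v). (x u - x v)\<^sup>2"]
  have "(\<Sum>(i, j)\<in>E'. ((x \<circ> p) i - (x \<circ> p) j)\<^sup>2) = (\<Sum>(u, v)\<in>E. (x u - x v)\<^sup>2)"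
    by (simp add: case_prod_unfold)
  then show "dirichlet_energy E' (x \<circ> p) = dirichlet_energy E x"
    by (simp add: dirichlet_energy_def)
qed

text \<open>
  The general case follows by numbering the vertices in the order of decreasing values.
\<close>

theorem energy_ge:
  assumes sum0: "(\<Sum>u<2 * n. x u) = 0" and n: "2 \<le> n"
  shows "(2 - 2 * cos (pi / real n)) * (\<Sum>u<2 * n. (x u)\<^sup>2) \<le> dirichlet_energy E x"
proof -
  define xs where "xs = sort_key (\<lambda>u. - x u) [0..<2 * n]"
  define p where "p i = xs ! i" for i
  have len: "length xs = 2 * n" and set: "set xs = {..<2 * n}" and dist: "distinct xs"
    by (auto simp: xs_def)
  have p: "bij_betw p {..<2 * n} {..<2 * n}"
    unfolding p_def by (rule bij_betw_nth) (use len set dist in auto)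
  have mono: "(x \<circ> p) (Suc i) \<le> (x \<circ> p) i" if "Suc i < 2 * n" for i
  proof -
    have "sorted (map (\<lambda>u. - x u) xs)" by (simp add: xs_def)
    then have "- x (xs ! i) \<le> - x (xs ! Suc i)"
      using sorted_nth_mono[of "map (\<lambda>u. - x u) xs" i "Suc i"] that len by simp
    then show ?thesis by (simp add: p_def)
  qed
  interpret R: connected_cubic_bipartite_arcs n
    "{(i, j). i < 2 * n \<and> j < 2 * n \<and> (p i, p j) \<in> E}" "col \<circ> p"
    by (rule relabel(1)[OF p])
  have "(\<Sum>u<2 * n. (x \<circ> p) u) = (\<Sum>u<2 * n. x u)"
    using sum.reindex_bij_betw[OF p, of x] by simp
  moreover have "(\<Sum>u<2 * n. ((x \<circ> p) u)\<^sup>2) = (\<Sum>u<2 * n. (x u)\<^sup>2)"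
    using sum.reindex_bij_betw[OF p, of "\<lambda>u. (x u)\<^sup>2"] by simp
  ultimately show ?thesis
    using R.energy_ge_sorted[of "x \<circ> p", OF mono] sum0 n relabel(2)[OF p, of x] by simp
qed

end

lemma out_degree_with_proj: "out_degree (with_proj G) v = card {w. (v, w) \<in> parcs G}"
proof -
  have "out_arcs (with_proj G) v = Pair v ` {w. (v, w) \<in> parcs G}"
    by (auto simp: out_arcs_def)
  then show ?thesis by (simp add: out_degree_def card_image inj_on_def)
qed

text \<open>
  If no arc leaves a set of vertices, then every vertex that is reachable from the set lies in it; this
  turns connectedness by walks into the cut condition.
\<close>

lemma graph_arcs_locale:
  assumes G: "G \<in> connected_cubic_bipartite_graphs n"
  obtains col where "connected_cubic_bipartite_arcs n (parcs G) col"
proof -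
  from G have V: "pverts G = {0..<2 * n}" and "pair_graph G" "cubic G" "bipartite G"
    and conn: "Digraph_Component.connected (with_proj G)"
    by (auto simp: connected_cubic_bipartite_graphs_def)
  interpret pair_graph G by fact
  have sym: "(v, u) \<in> parcs G" if "(u, v) \<in> parcs G" for u v
    using pair_sym_arcs that by (auto simp: symmetric_def sym_def)
  obtain A B where "A \<inter> B = {}"
    and AB: "\<forall>(u, v)\<in>parcs G. u \<in> A \<and> v \<in> B \<or> u \<in> B \<and> v \<in> A"
    using \<open>bipartite G\<close> unfolding bipartite_def by (elim exE conjE)
  have "connected_cubic_bipartite_arcs n (parcs G) (\<lambda>u. u \<in> A)"
  proof unfold_locales
    show "parcs G \<subseteq> {..<2 * n} \<times> {..<2 * n}" using in_arcsD1 in_arcsD2 V by auto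
    show "card {v. (u, v) \<in> parcs G} = 3" if "u < 2 * n" for u
      using \<open>cubic G\<close> that by (simp add: cubic_def V out_degree_with_proj)
    show "(u \<in> A) \<noteq> (v \<in> A)" if "(u, v) \<in> parcs G" for u v
      using bspec[OF AB that] \<open>A \<inter> B = {}\<close> by auto
    show "\<exists>u\<in>S. \<exists>v\<in>{..<2 * n} - S. (u, v) \<in> parcs G"
      if S: "S \<subseteq> {..<2 * n}" "S \<noteq> {}" "S \<noteq> {..<2 * n}" for S
    proof (rule ccontr)
      assume closed: "\<not> ?thesis"
      obtain u v where u: "u \<in> S" and v: "v < 2 * n" "v \<notin> S" using S by blast
      have "(u, v) \<in> rtrancl_on {0..<2 * n} ((parcs G)\<^sup>s)"
        using conn u v S(1) unfolding connected_conv by (auto simp: V)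
      then have "v \<in> S"
      proof (induction rule: rtrancl_on_induct)
        case base
        show ?case by (rule u)
      next
        case (step y z)
        from \<open>(y, z) \<in> (parcs G)\<^sup>s\<close> have "(y, z) \<in> parcs G \<or> (z, y) \<in> parcs G"
          by (auto simp: symcl_def)
        then have "(y, z) \<in> parcs G" using sym[of z y] by blast
        moreover have "z \<in> {..<2 * n}" using step by simp
        ultimately show ?case using step closed by blast
      qed
      with v show False by simp
    qed
  qed (rule sym)
  then show thesis by (rule that)
qed

lemma adjacency_matrix_eq:
  assumes "G \<in> connected_cubic_bipartite_graphs n"
  shows "adjacency_matrix G = mat (2 * n) (2 * n) (\<lambda>(i, j). if (i, j) \<in> parcs G then 1 else 0)"
  using assms by (simp add: adjacency_matrix_def connected_cubic_bipartite_graphs_def)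

lemma spectral_gap_ge:
  assumes G: "G \<in> connected_cubic_bipartite_graphs n" and n: "2 \<le> n"
  shows "2 - 2 * cos (pi / real n) \<le> spectral_gap G"
proof -
  obtain col where "connected_cubic_bipartite_arcs n (parcs G) col" using graph_arcs_locale[OF G] .
  then interpret connected_cubic_bipartite_arcs n "parcs G" col .
  have "2 \<le> 2 * n" using n by simp
  from adjacency_spectral_gap[OF this] obtain w where w: "(\<Sum>u<2 * n. w u) = 0" "(\<Sum>u<2 * n. (w u)\<^sup>2) = 1"
    "dirichlet_energy (parcs G) w = eigenvalues_desc arc_matrix ! 0 - eigenvalues_desc arc_matrix ! 1"
    by blast
  then show ?thesis
    using energy_ge[OF w(1) n] by (simp add: spectral_gap_def adjacency_matrix_eq[OF G] arc_matrix_def)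
qed

lemma spectral_gap_le:
  assumes G: "G \<in> connected_cubic_bipartite_graphs n" and n: "1 \<le> n"
    and x: "(\<Sum>u<2 * n. x u) = 0" "0 < (\<Sum>u<2 * n. (x u)\<^sup>2)"
    and e: "dirichlet_energy (parcs G) x \<le> c * (\<Sum>u<2 * n. (x u)\<^sup>2)"
  shows "spectral_gap G \<le> c"
proof -
  obtain col where "connected_cubic_bipartite_arcs n (parcs G) col" using graph_arcs_locale[OF G] .
  then interpret connected_cubic_bipartite_arcs n "parcs G" col .
  have "2 \<le> 2 * n" using n by simp
  from adjacency_spectral_gap[OF this]
  have "(eigenvalues_desc arc_matrix ! 0 - eigenvalues_desc arc_matrix ! 1) * (\<Sum>u<2 * n. (x u)\<^sup>2)
      \<le> dirichlet_energy (parcs G) x" using x(1) by metis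
  with e have "spectral_gap G * (\<Sum>u<2 * n. (x u)\<^sup>2) \<le> c * (\<Sum>u<2 * n. (x u)\<^sup>2)"
    by (simp add: spectral_gap_def adjacency_matrix_eq[OF G] arc_matrix_def)
  with x(2) show ?thesis by (simp add: mult_le_cancel_right)
qed

section \<open>The ladder with closed ends and the upper bound\<close>

text \<open>
  The vertices \<open>2 j\<close> and \<open>2 j + 1\<close> are joined by rung \<open>j\<close>, and \<open>i \<mapsto> i + 2\<close> runs along the two
  sides. Rungs \<open>2\<close> and \<open>n - 3\<close> are left out, and two chords join the corners of either end to the end
  points of the missing rung: the three rungs at an end then span \<open>K\<^bsub>3,3\<^esub>\<close> minus that missing edge.
\<close>

definition ladder_edge :: "nat \<Rightarrow> nat \<Rightarrow> nat \<Rightarrow> bool" where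
  "ladder_edge n i j \<longleftrightarrow> j = i + 2 \<or> even i \<and> j = i + 1 \<and> i \<noteq> 4 \<and> i + 6 \<noteq> 2 * n
     \<or> i = 0 \<and> j = 5 \<or> i = 1 \<and> j = 4
     \<or> i + 6 = 2 * n \<and> j + 1 = 2 * n \<or> i + 5 = 2 * n \<and> j + 2 = 2 * n"

definition ladder :: "nat \<Rightarrow> nat pair_pre_digraph" where
  "ladder n = \<lparr>pverts = {0..<2 * n},
     parcs = {(i, j). i < 2 * n \<and> j < 2 * n \<and> (ladder_edge n i j \<or> ladder_edge n j i)}\<rparr>"

lemma ladder_arc_iff:
  "(i, j) \<in> parcs (ladder n) \<longleftrightarrow> i < 2 * n \<and> j < 2 * n \<and> (ladder_edge n i j \<or> ladder_edge n j i)"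
  by (simp add: ladder_def)

lemma pverts_ladder [simp]: "pverts (ladder n) = {0..<2 * n}"
  by (simp add: ladder_def)

text \<open>
  Exceptional are the two corners and the two end points of the missing rung at either end; at all other
  vertices the neighbours are the two along the side and the one across the rung.
\<close>

lemma card_ladder_neighbours:
  assumes n: "8 \<le> n" and i: "i < 2 * n"
  shows "card {j. (i, j) \<in> parcs (ladder n)} = 3"
proof -
  have *: "card {j. (i, j) \<in> parcs (ladder n)} = 3"
    if "\<And>j. (i, j) \<in> parcs (ladder n) \<longleftrightarrow> j = a \<or> j = b \<or> j = c" "a < b" "b < c" for a b c
  proof -
    have "{j. (i, j) \<in> parcs (ladder n)} = {a, b, c}" using that(1) by auto
    then show ?thesis using that(2,3) by simp
  qed
  note iff = ladder_arc_iff ladder_edge_def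
  obtain m where m: "n = m + 8" using n by (metis add.commute le_Suc_ex)
  consider "i = 0" | "i = 1" | "i = 4" | "i = 5"
    | "i + 6 = 2 * n" | "i + 5 = 2 * n" | "i + 2 = 2 * n" | "i + 1 = 2 * n"
    | "even i" "i \<notin> {0, 4}" "i + 6 \<noteq> 2 * n" "i + 2 < 2 * n"
    | "odd i" "i \<notin> {1, 5}" "i + 5 \<noteq> 2 * n" "i + 2 < 2 * n"
    using i by force
  note split = this
  \<comment> \<open>Without this bound, the inequations between vertices split linear arithmetic into
    exponentially many cases.\<close>
  note [[linarith_neq_limit = 1]]
  from split show ?thesis
  proof cases
    case 1
    then show ?thesis using n by (intro *[of 1 2 5]) (auto simp: iff)
  next
    case 2
    then show ?thesis using n by (intro *[of 0 3 4]) (auto simp: iff)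
  next
    case 3
    then show ?thesis using n by (intro *[of 1 2 6]) (auto simp: iff)
  next
    case 4
    then show ?thesis using n by (intro *[of 0 3 7]) (auto simp: iff)
  next
    case 5
    with m have i: "i = 2 * m + 10" by simp
    show ?thesis unfolding m i
      by (intro *[unfolded m i, of "2 * m + 8" "2 * m + 12" "2 * m + 15"])
         (simp_all add: iff, presburger)
  next
    case 6
    with m have i: "i = 2 * m + 11" by simp
    show ?thesis unfolding m i
      by (intro *[unfolded m i, of "2 * m + 9" "2 * m + 13" "2 * m + 14"])
         (simp_all add: iff, presburger)
  next
    case 7
    with m have i: "i = 2 * m + 14" by simp
    show ?thesis unfolding m i
      by (intro *[unfolded m i, of "2 * m + 11" "2 * m + 12" "2 * m + 15"])
         (simp_all add: iff, presburger)
  next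
    case 8
    with m have i: "i = 2 * m + 15" by simp
    show ?thesis unfolding m i
      by (intro *[unfolded m i, of "2 * m + 10" "2 * m + 13" "2 * m + 14"])
         (simp_all add: iff, presburger)
  next
    case 9
    then obtain k where "i = 2 * k" by (auto elim: evenE)
    moreover from this 9 have "k \<noteq> 0" by auto
    then obtain l where "k = Suc l" using not0_implies_Suc by blast
    ultimately have i: "i = 2 * l + 2" by simp
    have l: "l \<noteq> 1" "l \<noteq> m + 4" "l < m + 6" using 9 by (auto simp: m i)
    have ne: "2 * l + 2 + 5 \<noteq> 2 * (m + 8)" "2 * l + 2 + 1 \<noteq> 2 * (m + 8)" "2 * l + 2 \<noteq> 5" "\<And>j. even j \<Longrightarrow> 2 * l + 2 \<noteq> j + 1"
      by presburger+
    have ne': "2 * l + 2 + 6 \<noteq> 2 * (m + 8)" "2 * l + 2 + 2 \<noteq> 2 * (m + 8)" "2 * l + 2 \<noteq> 4" "2 * l + 2 \<noteq> 0" "2 * l + 2 \<noteq> 1"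
      using l by presburger+
    have edges: "ladder_edge (m + 8) (2 * l) (2 * l + 2)" "ladder_edge (m + 8) (2 * l + 2) (2 * l + 3)" "ladder_edge (m + 8) (2 * l + 2) (2 * l + 4)"
      unfolding ladder_edge_def using l by presburger+
    have "(2 * l + 2, j) \<in> parcs (ladder (m + 8)) \<longleftrightarrow> j = 2 * l \<or> j = 2 * l + 3 \<or> j = 2 * l + 4" for j
    proof
      assume "(2 * l + 2, j) \<in> parcs (ladder (m + 8))"
      then have "ladder_edge (m + 8) (2 * l + 2) j \<or> ladder_edge (m + 8) j (2 * l + 2)"
        unfolding ladder_arc_iff by blast
      then have "j = 2 * l + 2 + 2 \<or> j = 2 * l + 2 + 1 \<or> 2 * l + 2 = j + 2"
        unfolding ladder_edge_def using ne ne' by blast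
      then show "j = 2 * l \<or> j = 2 * l + 3 \<or> j = 2 * l + 4" by presburger
    next
      assume "j = 2 * l \<or> j = 2 * l + 3 \<or> j = 2 * l + 4"
      moreover have "2 * l + 4 < 2 * (m + 8)" using l(3) by simp
      ultimately show "(2 * l + 2, j) \<in> parcs (ladder (m + 8))"
        unfolding ladder_arc_iff using edges by (elim disjE) simp_all
    qed
    from *[unfolded m i, OF this] show ?thesis unfolding m i by simp
  next
    case 10
    then obtain k where "i = 2 * k + 1" by (auto elim: oddE)
    moreover from this 10 have "k \<noteq> 0" by auto
    then obtain l where "k = Suc l" using not0_implies_Suc by blast
    ultimately have i: "i = 2 * l + 3" by simp
    have l: "l \<noteq> 1" "l \<noteq> m + 4" "l < m + 6" using 10 by (auto simp: m i)
    have ne: "2 * l + 3 + 6 \<noteq> 2 * (m + 8)" "2 * l + 3 + 2 \<noteq> 2 * (m + 8)" "2 * l + 3 \<noteq> 4" "odd (2 * l + 3)"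
      by presburger+
    have ne': "2 * l + 3 + 5 \<noteq> 2 * (m + 8)" "2 * l + 3 + 1 \<noteq> 2 * (m + 8)" "2 * l + 3 \<noteq> 5" "2 * l + 3 \<noteq> 0" "2 * l + 3 \<noteq> 1"
      using l by presburger+
    have edges: "ladder_edge (m + 8) (2 * l + 1) (2 * l + 3)" "ladder_edge (m + 8) (2 * l + 2) (2 * l + 3)" "ladder_edge (m + 8) (2 * l + 3) (2 * l + 5)"
      unfolding ladder_edge_def using l by presburger+
    have "(2 * l + 3, j) \<in> parcs (ladder (m + 8)) \<longleftrightarrow> j = 2 * l + 1 \<or> j = 2 * l + 2 \<or> j = 2 * l + 5" for j
    proof
      assume "(2 * l + 3, j) \<in> parcs (ladder (m + 8))"
      then have "ladder_edge (m + 8) (2 * l + 3) j \<or> ladder_edge (m + 8) j (2 * l + 3)"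
        unfolding ladder_arc_iff by blast
      then have "j = 2 * l + 3 + 2 \<or> 2 * l + 3 = j + 2 \<or> 2 * l + 3 = j + 1"
        unfolding ladder_edge_def using ne ne' by blast
      then show "j = 2 * l + 1 \<or> j = 2 * l + 2 \<or> j = 2 * l + 5" by presburger
    next
      assume "j = 2 * l + 1 \<or> j = 2 * l + 2 \<or> j = 2 * l + 5"
      moreover have "2 * l + 5 < 2 * (m + 8)" using l(3) by simp
      ultimately show "(2 * l + 3, j) \<in> parcs (ladder (m + 8))"
        unfolding ladder_arc_iff using edges by (elim disjE) simp_all
    qed
    from *[unfolded m i, OF this] show ?thesis unfolding m i by simp
  qed
qed

lemma ladder_edge_less: "ladder_edge n i j \<Longrightarrow> i < j"
  unfolding ladder_edge_def by (elim disjE conjE) linarith+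

lemma pair_graph_ladder: "pair_graph (ladder n)"
proof
  show "finite (parcs (ladder n))"
    by (rule finite_subset[of _ "{0..<2 * n} \<times> {0..<2 * n}"]) (auto simp: ladder_arc_iff)
  show "symmetric (with_proj (ladder n))"
    by (auto simp: symmetric_def sym_def ladder_arc_iff)
  show "fst e \<noteq> snd e" if "e \<in> parcs (ladder n)" for e
    using that by (cases e) (auto simp: ladder_arc_iff dest: ladder_edge_less)
qed (auto simp: ladder_arc_iff)

text \<open>
  The colour of a vertex is the parity of its rung plus its side; along the numbering the colours repeat
  with period 4 in the pattern \<open>0, 1, 1, 0\<close>.
\<close>

lemma bipartite_ladder: "bipartite (ladder n)"
proof -
  define col :: "nat \<Rightarrow> bool" where "col i \<longleftrightarrow> i mod 4 = 0 \<or> i mod 4 = 3" for i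
  have flip: "col i \<noteq> col j" if "ladder_edge n i j" for i j
  proof -
    have "even i \<and> (j = i + 1 \<or> j = i + 5) \<or> odd i \<and> j = i + 3 \<or> j = i + 2"
      using that unfolding ladder_edge_def
    proof (elim disjE conjE)
      assume a: "i + 6 = 2 * n" "j + 1 = 2 * n"
      have "even i" using a(1) by presburger
      with a show ?thesis by simp
    next
      assume a: "i + 5 = 2 * n" "j + 2 = 2 * n"
      have "odd i" using a(1) by presburger
      with a show ?thesis by simp
    qed simp_all
    then show ?thesis
    proof (elim disjE conjE)
      assume "j = i + 2"
      then show ?thesis unfolding col_def by presburger
    qed (unfold col_def, presburger+)
  qed
  show ?thesis
    unfolding bipartite_def
    by (rule exI[of _ "{i. i < 2 * n \<and> col i}"], rule exI[of _ "{i. i < 2 * n \<and> \<not> col i}"])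
       (auto simp: ladder_arc_iff dest: flip)
qed

lemma connected_ladder:
  assumes "8 \<le> n"
  shows "Digraph_Component.connected (with_proj (ladder n))"
proof -
  let ?R = "rtrancl_on {0..<2 * n} ((parcs (ladder n))\<^sup>s)"
  have from_0: "(0, i) \<in> ?R" if "i < 2 * n" for i
    using that
  proof (induction i rule: less_induct)
    case (less i)
    consider "i = 0" | "i = 1" | j where "i = j + 2"
      by (cases "i < 2") (force, metis le_add_diff_inverse2 not_less)
    then show ?case
    proof cases
      case 1
      then show ?thesis using assms by auto
    next
      case 2
      then have "(0, i) \<in> parcs (ladder n)"
        unfolding ladder_arc_iff ladder_edge_def using assms by simp
      then have "(0, i) \<in> (parcs (ladder n))\<^sup>s" by (simp add: symcl_def)
      then show ?thesis using assms less.prems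
        by (intro rtrancl_on_into_rtrancl_on[OF rtrancl_on_refl]) auto
    next
      case 3
      then have "(j, i) \<in> parcs (ladder n)"
        unfolding ladder_arc_iff ladder_edge_def using less.prems by simp
      then have "(j, i) \<in> (parcs (ladder n))\<^sup>s" by (simp add: symcl_def)
      moreover have "(0, j) \<in> ?R" using less 3 by auto
      ultimately show ?thesis using less.prems by (rule_tac rtrancl_on_into_rtrancl_on[of 0 j]) auto
    qed
  qed
  have "sym ((parcs (ladder n))\<^sup>s)" by (auto simp: sym_def symcl_def)
  then have "sym ?R" by (rule rtrancl_on_sym)
  then have "(u, v) \<in> ?R" if "u < 2 * n" "v < 2 * n" for u v
    using rtrancl_on_trans[OF symD[OF _ from_0[OF that(1)]] from_0[OF that(2)]] by blast
  then show ?thesis using assms unfolding connected_conv by simp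
qed

lemma ladder_in_graphs: "8 \<le> n \<Longrightarrow> ladder n \<in> connected_cubic_bipartite_graphs n"
  by (simp add: connected_cubic_bipartite_graphs_def pair_graph_ladder bipartite_ladder
      connected_ladder cubic_def out_degree_with_proj card_ladder_neighbours)

text \<open>
  The test function on rung \<open>j\<close>: the extremal cosine of a path with \<open>m = n - 6\<close> vertices on the rungs
  \<open>3, \<dots>, n - 4\<close>. On either end block it keeps the value of the nearest of these rungs, which truncated
  subtraction and the minimum achieve.
\<close>

definition ladder_mode :: "nat \<Rightarrow> nat \<Rightarrow> real" where
  "ladder_mode m j = cos (pi * (real (min (j - 3) (m - 1)) + 1 / 2) / real m)"

text \<open>
  With \<open>n = m + 6\<close> rungs, \<open>m + 5 - j\<close> is the reflected rung \<open>n - 1 - j\<close>.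
\<close>

lemma ladder_mode_reflect:
  assumes "2 \<le> m" "j < m + 6"
  shows "ladder_mode m (m + 5 - j) = - ladder_mode m j"
proof -
  define k where "k = min (j - 3) (m - 1)"
  have "k < m" using assms by (auto simp: k_def)
  have "min (m + 5 - j - 3) (m - 1) = m - 1 - k" using assms by (auto simp: k_def)
  moreover have "pi * (real (m - 1 - k) + 1 / 2) / real m = pi - pi * (real k + 1 / 2) / real m"
    using \<open>k < m\<close> by (simp add: of_nat_diff field_simps)
  ultimately have "ladder_mode m (m + 5 - j) = cos (pi - pi * (real k + 1 / 2) / real m)"
    by (simp only: ladder_mode_def)
  then show ?thesis by (simp add: ladder_mode_def k_def)
qed

lemma ladder_mode_edge:
  assumes n: "n = m + 6" "2 \<le> m" and ij: "ladder_edge n i j" "j \<noteq> i + 2"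
  shows "ladder_mode m (i div 2) = ladder_mode m (j div 2)"
proof -
  have "min (i div 2 - 3) (m - 1) = min (j div 2 - 3) (m - 1)"
    using ij unfolding ladder_edge_def n(1)
  proof (elim disjE conjE)
    assume "even i" "j = i + 1"
    then show ?thesis by (auto elim!: evenE)
  next
    assume "i + 6 = 2 * (m + 6)" "j + 1 = 2 * (m + 6)"
    then have "i div 2 = m + 3" "j div 2 = m + 5" by presburger+
    then show ?thesis by simp
  next
    assume "i + 5 = 2 * (m + 6)" "j + 2 = 2 * (m + 6)"
    then have "i div 2 = m + 3" "j div 2 = m + 5" by presburger+
    then show ?thesis by simp
  qed simp_all
  then show ?thesis by (simp add: ladder_mode_def)
qed

text \<open>
  A function that depends on the rung only, and is constant along all edges other than the sides, has
  the energy of a path for each of the two sides.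
\<close>

lemma ladder_energy:
  fixes f :: "nat \<Rightarrow> real"
  assumes n: "2 \<le> n"
    and f: "\<And>i j. ladder_edge n i j \<Longrightarrow> j \<noteq> i + 2 \<Longrightarrow> f (i div 2) = f (j div 2)"
  shows "dirichlet_energy (parcs (ladder n)) (\<lambda>i. f (i div 2)) =
    2 * (\<Sum>k<n - 1. (f k - f (Suc k))\<^sup>2)"
proof -
  let ?x = "\<lambda>i. f (i div 2)"
  let ?E = "parcs (ladder n)"
  define T where "T = (\<lambda>i. (i, i + 2)) ` {..<2 * n - 2}"
  have fin: "finite T" "finite (prod.swap ` T)" by (auto simp: T_def)
  have T: "(\<Sum>(u, v)\<in>T. (?x u - ?x v)\<^sup>2) = 2 * (\<Sum>k<n - 1. (f k - f (Suc k))\<^sup>2)"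
  proof -
    have "(\<Sum>(u, v)\<in>T. (?x u - ?x v)\<^sup>2) = (\<Sum>i<2 * (n - 1). (?x i - ?x (i + 2))\<^sup>2)"
      unfolding T_def by (subst sum.reindex) (auto simp: inj_on_def diff_mult_distrib2)
    then show ?thesis by (simp add: sum_even_odd sum_distrib_left)
  qed
  have swapT: "(\<Sum>(u, v)\<in>prod.swap ` T. (?x u - ?x v)\<^sup>2) = (\<Sum>(u, v)\<in>T. (?x u - ?x v)\<^sup>2)"
    by (subst sum.reindex) (auto simp: case_prod_unfold power2_commute)
  have "(\<Sum>(u, v)\<in>?E. (?x u - ?x v)\<^sup>2) = (\<Sum>(u, v)\<in>T \<union> prod.swap ` T. (?x u - ?x v)\<^sup>2)"
  proof (rule sum.mono_neutral_right)
    show "finite ?E"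
      by (rule finite_subset[of _ "{0..<2 * n} \<times> {0..<2 * n}"]) (auto simp: ladder_arc_iff)
    show "T \<union> prod.swap ` T \<subseteq> ?E"
      unfolding T_def using n by (auto simp: ladder_arc_iff ladder_edge_def[of n _ "Suc (Suc _)"])
    have "f (i div 2) = f (j div 2)" if "(i, j) \<in> ?E" "(i, j) \<notin> T" "(j, i) \<notin> T" for i j
    proof -
      have "j \<noteq> i + 2" "i \<noteq> j + 2" using that unfolding T_def ladder_arc_iff by auto
      moreover have "ladder_edge n i j \<or> ladder_edge n j i" using that(1) by (simp add: ladder_arc_iff)
      ultimately show ?thesis using f by metis
    qed
    then show "\<forall>p\<in>?E - (T \<union> prod.swap ` T). (case p of (u, v) \<Rightarrow> (?x u - ?x v)\<^sup>2) = 0"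
      by (force simp: image_iff)
  qed
  also have "\<dots> = (\<Sum>(u, v)\<in>T. (?x u - ?x v)\<^sup>2) + (\<Sum>(u, v)\<in>prod.swap ` T. (?x u - ?x v)\<^sup>2)"
    by (rule sum.union_disjoint) (auto simp: fin T_def)
  finally show ?thesis by (simp add: dirichlet_energy_def swapT T)
qed

text \<open>
  The end blocks add nothing to the energy and can only increase the norm, so the quotient is at most
  that of the path with \<open>m\<close> vertices. The sum is 0 because the function is antisymmetric under the
  reflection \<open>j \<mapsto> n - 1 - j\<close> of the rungs.
\<close>

lemma spectral_gap_ladder_le:
  assumes n: "n = m + 6" "2 \<le> m"
  shows "spectral_gap (ladder n) \<le> 2 - 2 * cos (pi / real m)"
proof (rule spectral_gap_le)
  let ?f = "ladder_mode m"
  define g where "g k = cos (pi * (real k + 1 / 2) / real m)" for k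
  have fg: "?f (k + 3) = g k" if "k < m" for k
    using that by (simp add: ladder_mode_def g_def)
  have sq_le: "2 * (\<Sum>k<m. (g k)\<^sup>2) \<le> (\<Sum>u<2 * n. (?f (u div 2))\<^sup>2)"
  proof -
    have "(\<Sum>k<m. (g k)\<^sup>2) = (\<Sum>k<m. (?f (k + 3))\<^sup>2)" by (intro sum.cong refl) (simp add: fg)
    also have "\<dots> = (\<Sum>k\<in>(\<lambda>k. k + 3) ` {..<m}. (?f k)\<^sup>2)"
      by (subst sum.reindex) (auto simp: inj_on_def)
    also have "\<dots> \<le> (\<Sum>k<n. (?f k)\<^sup>2)" by (rule sum_mono2) (auto simp: n)
    finally show ?thesis by (simp add: sum_even_odd sum_distrib_left[symmetric])
  qed
  show "ladder n \<in> connected_cubic_bipartite_graphs n" using n by (intro ladder_in_graphs) simp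
  show "1 \<le> n" using n by simp
  have "(\<Sum>k<n. ?f k) = (\<Sum>k<n. ?f (n - Suc k))" by (rule sum.nat_diff_reindex[symmetric])
  also have "\<dots> = (\<Sum>k<n. - ?f k)"
  proof (rule sum.cong)
    fix k assume "k \<in> {..<n}"
    moreover have "n - Suc k = m + 5 - k" by (simp add: n)
    ultimately show "?f (n - Suc k) = - ?f k" using ladder_mode_reflect[of m k] n by simp
  qed simp
  finally have "(\<Sum>k<n. ?f k) = 0" by (simp add: sum_negf)
  then show "(\<Sum>u<2 * n. ?f (u div 2)) = 0"
    by (simp add: sum_even_odd sum_distrib_left[symmetric])
  have "0 < (\<Sum>k<m. (g k)\<^sup>2)"
  proof (rule sum_pos2[of _ 0])
    have "0 < g 0" unfolding g_def using n by (intro cos_gt_zero) (auto simp: field_simps)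
    then show "0 < (g 0)\<^sup>2" by simp
  qed (use n in auto)
  with sq_le show "0 < (\<Sum>u<2 * n. (?f (u div 2))\<^sup>2)" by simp
  have "dirichlet_energy (parcs (ladder n)) (\<lambda>i. ?f (i div 2)) = 2 * (\<Sum>k<n - 1. (?f k - ?f (Suc k))\<^sup>2)"
    by (rule ladder_energy) (use n ladder_mode_edge in auto)
  also have "(\<Sum>k<n - 1. (?f k - ?f (Suc k))\<^sup>2) = (\<Sum>k\<in>(\<lambda>k. k + 3) ` {..<m - 1}. (?f k - ?f (Suc k))\<^sup>2)"
  proof (rule sum.mono_neutral_right)
    show "\<forall>k\<in>{..<n - 1} - (\<lambda>k. k + 3) ` {..<m - 1}. (?f k - ?f (Suc k))\<^sup>2 = 0"
    proof
      fix k assume k: "k \<in> {..<n - 1} - (\<lambda>k. k + 3) ` {..<m - 1}"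
      have "k < 3 \<or> m + 2 \<le> k"
      proof (rule ccontr)
        assume "\<not> ?thesis"
        then have "k = (k - 3) + 3" "k - 3 < m - 1" by auto
        then have "k \<in> (\<lambda>k. k + 3) ` {..<m - 1}" by blast
        with k show False by simp
      qed
      then have "min (k - 3) (m - 1) = min (Suc k - 3) (m - 1)" by auto
      then show "(?f k - ?f (Suc k))\<^sup>2 = 0" by (simp add: ladder_mode_def)
    qed
  qed (auto simp: n)
  also have "\<dots> = (\<Sum>k<m - 1. (?f (k + 3) - ?f (Suc k + 3))\<^sup>2)"
    by (subst sum.reindex) (auto simp: inj_on_def)
  also have "\<dots> = (\<Sum>k<m - 1. (g k - g (Suc k))\<^sup>2)"
  proof (rule sum.cong)
    fix k assume "k \<in> {..<m - 1}"
    then show "(?f (k + 3) - ?f (Suc k + 3))\<^sup>2 = (g k - g (Suc k))\<^sup>2"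
      using fg[of k] fg[of "Suc k"] by simp
  qed simp
  also have "\<dots> = (2 - 2 * cos (pi / real m)) * (\<Sum>k<m. (g k)\<^sup>2)"
    using path_cosine_energy[of m] n by (simp add: g_def)
  also have "2 * ((2 - 2 * cos (pi / real m)) * (\<Sum>k<m. (g k)\<^sup>2)) =
      (2 - 2 * cos (pi / real m)) * (2 * (\<Sum>k<m. (g k)\<^sup>2))" by simp
  also have "\<dots> \<le> (2 - 2 * cos (pi / real m)) * (\<Sum>u<2 * n. (?f (u div 2))\<^sup>2)"
    by (intro mult_left_mono sq_le) simp
  finally show "dirichlet_energy (parcs (ladder n)) (\<lambda>u. ?f (u div 2)) \<le>
      (2 - 2 * cos (pi / real m)) * (\<Sum>u<2 * n. (?f (u div 2))\<^sup>2)" .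
qed

section \<open>Asymptotics of the minimum spectral gap\<close>

lemma min_spectral_gap_bounds:
  assumes "8 \<le> n"
  shows "2 - 2 * cos (pi / real n) \<le> min_spectral_gap n"
    and "min_spectral_gap n \<le> 2 - 2 * cos (pi / (real n - 6))"
proof -
  have fin: "finite (spectral_gap ` connected_cubic_bipartite_graphs n)"
    by (rule finite_imageI[OF finite_connected_cubic_bipartite_graphs])
  have L: "ladder n \<in> connected_cubic_bipartite_graphs n" by (rule ladder_in_graphs[OF assms])
  show "2 - 2 * cos (pi / real n) \<le> min_spectral_gap n"
    unfolding min_spectral_gap_def using L spectral_gap_ge[of _ n] assms
    by (intro Min.boundedI[OF fin]) auto
  have "min_spectral_gap n \<le> spectral_gap (ladder n)"
    unfolding min_spectral_gap_def using L by (intro Min_le[OF fin]) auto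
  also have "\<dots> \<le> 2 - 2 * cos (pi / real (n - 6))"
    by (rule spectral_gap_ladder_le) (use assms in auto)
  finally show "min_spectral_gap n \<le> 2 - 2 * cos (pi / (real n - 6))"
    using assms by (simp add: of_nat_diff)
qed

theorem theorem4p1:
  shows "(\<lambda>n::nat. (real n)\<^sup>2 / pi\<^sup>2 * min_spectral_gap n) \<longlonglongrightarrow> 1"
proof (rule tendsto_sandwich)
  show "\<forall>\<^sub>F n::nat in sequentially.
      (real n)\<^sup>2 / pi\<^sup>2 * (2 - 2 * cos (pi / real n)) \<le> (real n)\<^sup>2 / pi\<^sup>2 * min_spectral_gap n"
    using eventually_ge_at_top[of 8]
    by eventually_elim (intro mult_left_mono min_spectral_gap_bounds(1); simp)
  show "\<forall>\<^sub>F n::nat in sequentially. (real n)\<^sup>2 / pi\<^sup>2 * min_spectral_gap n \<le>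
      (real n)\<^sup>2 / pi\<^sup>2 * (2 - 2 * cos (pi / (real n - 6)))"
    using eventually_ge_at_top[of 8]
    by eventually_elim (intro mult_left_mono min_spectral_gap_bounds(2); simp)
  show "(\<lambda>n::nat. (real n)\<^sup>2 / pi\<^sup>2 * (2 - 2 * cos (pi / real n))) \<longlonglongrightarrow> 1"
    by real_asymp (simp add: power2_eq_square field_simps)
  show "(\<lambda>n::nat. (real n)\<^sup>2 / pi\<^sup>2 * (2 - 2 * cos (pi / (real n - 6)))) \<longlonglongrightarrow> 1"
    by real_asymp (simp add: power2_eq_square field_simps)
qed

end
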